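(* Fix integers $d,m,n$ with $n\geq 3$ and $d\geq m>1$. Then there exists a hypersurface $X$ of degree $d$ in $\mathbf{P}^n$ with an ordinary $m$-fold point and no further singularities such that $\delta_{X}\geq \left\lfloor \frac{m}{2}\right\rfloor^n$.
   Context: We work over $\mathbf{C}$. $V^n_{d,\delta}\subset \mathbf{P}(\mathbf{C}[x_0,\dots,x_n]_d)$ denotes the Severi variety of degree $d$ hypersurfaces in $\mathbf{P}^n$ with $\delta$ nodes (precisely $\delta$ nodes and no other singularities); a node is an ordinary double point. For a singular hypersurface $X\subset\mathbf{P}^n$ of degree $d$, $\delta_X$ is the maximal value of $\delta$ such that the point corresponding to $X$ lies in the closure of $V^n_{d,\delta}$ in $\mathbf{P}(\mathbf{C}[x_0,\dots,x_n]_d)$. An ordinary $m$-fold point of a hypersurface in $\mathbf{P}^n$ is an isolated singularity of multiplicity $m$ whose tangent cone is a cone over a smooth hypersurface of degree $m$ in $\mathbf{P}^{n-1}$. *)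

theory Defs
  imports Complex_Main "HOL-Library.Poly_Mapping"
begin

text \<open>
  Polynomials over the complex numbers in variables indexed by an arbitrary type: a monomial is a
  finitely supported exponent vector, a polynomial a finitely supported family of coefficients.
  The index type is left general because polynomials occur both in the homogeneous coordinates
  of $P^n$ (indexed by \<open>{..n}\<close>) and in those of the space of hypersurfaces
  (indexed by the monomials of degree \<open>d\<close>).
\<close>

type_synonym 'i monom = "'i \<Rightarrow>\<^sub>0 nat"
type_synonym 'i cpoly = "'i monom \<Rightarrow>\<^sub>0 complex"

definition mdegree :: "'i monom \<Rightarrow> nat" where
  "mdegree a = (\<Sum>i\<in>Poly_Mapping.keys a. Poly_Mapping.lookup a i)"

definition monoms :: "'i set \<Rightarrow> nat \<Rightarrow> 'i monom set" where
  "monoms I d = {a. Poly_Mapping.keys a \<subseteq> I \<and> mdegree a = d}"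

definition forms :: "'i set \<Rightarrow> nat \<Rightarrow> 'i cpoly set" where
  "forms I d = {p. Poly_Mapping.keys p \<subseteq> monoms I d}"

definition PVar :: "'i \<Rightarrow> 'i cpoly" where
  "PVar i = Poly_Mapping.single (Poly_Mapping.single i 1) 1"

definition PConst :: "complex \<Rightarrow> 'i cpoly" where
  "PConst c = Poly_Mapping.single 0 c"

definition insert_with :: "(complex \<Rightarrow> 'b::comm_semiring_1) \<Rightarrow> ('i \<Rightarrow> 'b) \<Rightarrow> 'i cpoly \<Rightarrow> 'b" where
  "insert_with \<phi> s p =
     (\<Sum>a\<in>Poly_Mapping.keys p. \<phi> (Poly_Mapping.lookup p a) *
        (\<Prod>i\<in>Poly_Mapping.keys a. s i ^ Poly_Mapping.lookup a i))"

definition peval :: "('i \<Rightarrow> complex) \<Rightarrow> 'i cpoly \<Rightarrow> complex" where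
  "peval = insert_with (\<lambda>c. c)"

definition psubst :: "('i \<Rightarrow> 'i cpoly) \<Rightarrow> 'i cpoly \<Rightarrow> 'i cpoly" where
  "psubst = insert_with PConst"

text \<open>In the terms with exponent \<open>0\<close> at \<open>i\<close> the subtraction is truncated, but their
  coefficient vanishes.\<close>

definition partial :: "'i \<Rightarrow> 'i cpoly \<Rightarrow> 'i cpoly" where
  "partial i p = (\<Sum>a\<in>Poly_Mapping.keys p.
     Poly_Mapping.single (a - Poly_Mapping.single i 1)
       (of_nat (Poly_Mapping.lookup a i) * Poly_Mapping.lookup p a))"

definition hom_component :: "nat \<Rightarrow> 'i cpoly \<Rightarrow> 'i cpoly" where
  "hom_component k p =
     (\<Sum>a | a \<in> Poly_Mapping.keys p \<and> mdegree a = k.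
        Poly_Mapping.single a (Poly_Mapping.lookup p a))"

text \<open>
  The projective space with homogeneous coordinates indexed by \<open>I\<close>. Vectors are functions
  vanishing outside \<open>I\<close>, and a point is the set of all its homogeneous coordinate vectors.
\<close>

definition proj_point :: "('i \<Rightarrow> complex) \<Rightarrow> ('i \<Rightarrow> complex) set" where
  "proj_point x = {(\<lambda>i. c * x i) | c. c \<noteq> 0}"

definition proj_space :: "'i set \<Rightarrow> ('i \<Rightarrow> complex) set set" where
  "proj_space I = {proj_point x | x. (\<forall>i. i \<notin> I \<longrightarrow> x i = 0) \<and> (\<exists>i\<in>I. x i \<noteq> 0)}"

definition vanishes_at :: "'i cpoly \<Rightarrow> ('i \<Rightarrow> complex) set \<Rightarrow> bool" where
  "vanishes_at G P \<longleftrightarrow> (\<forall>x\<in>P. peval x G = 0)"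

definition zariski_closure ::
  "'i set \<Rightarrow> ('i \<Rightarrow> complex) set set \<Rightarrow> ('i \<Rightarrow> complex) set set" where
  "zariski_closure I S = {P \<in> proj_space I.
     \<forall>e. \<forall>G\<in>forms I e. (\<forall>Q\<in>S. vanishes_at G Q) \<longrightarrow> vanishes_at G P}"

definition sing_locus :: "'i set \<Rightarrow> 'i cpoly \<Rightarrow> ('i \<Rightarrow> complex) set set" where
  "sing_locus I F = {P \<in> proj_space I. vanishes_at F P \<and> (\<forall>i\<in>I. vanishes_at (partial i F) P)}"

definition smooth_hypersurface :: "'i set \<Rightarrow> nat \<Rightarrow> 'i cpoly \<Rightarrow> bool" where
  "smooth_hypersurface I d F \<longleftrightarrow> F \<in> forms I d \<and> F \<noteq> 0 \<and> sing_locus I F = {}"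

definition isolated_singularity :: "'i set \<Rightarrow> 'i cpoly \<Rightarrow> ('i \<Rightarrow> complex) set \<Rightarrow> bool" where
  "isolated_singularity I F P \<longleftrightarrow>
     P \<in> sing_locus I F \<and> P \<notin> zariski_closure I (sing_locus I F - {P})"

text \<open>
  For a coordinate vector \<open>x\<close> with \<open>x j = 1\<close>, this is the equation of the hypersurface in the
  affine chart where the \<open>j\<close>-th coordinate is \<open>1\<close>, translated so that \<open>x\<close> becomes the origin.
  It is a polynomial in the variables indexed by \<open>I - {j}\<close>.
\<close>

definition local_equation :: "'i \<Rightarrow> ('i \<Rightarrow> complex) \<Rightarrow> 'i cpoly \<Rightarrow> 'i cpoly" where
  "local_equation j x F = psubst (\<lambda>i. PConst (x i) + (if i = j then 0 else PVar i)) F"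

definition multiplicity_at_0 :: "'i cpoly \<Rightarrow> nat" where
  "multiplicity_at_0 f = (LEAST k. hom_component k f \<noteq> 0)"

definition tangent_cone :: "'i cpoly \<Rightarrow> 'i cpoly" where
  "tangent_cone f = hom_component (multiplicity_at_0 f) f"

text \<open>
  The multiplicity, and the tangent cone up to a linear isomorphism, do not depend on the chart
  \<open>j\<close>. The tangent cone is the cone over a hypersurface in the projective space
  with coordinates indexed by \<open>I - {j}\<close>, whose dimension is one less.
\<close>

definition ordinary_point :: "'i set \<Rightarrow> nat \<Rightarrow> 'i cpoly \<Rightarrow> ('i \<Rightarrow> complex) set \<Rightarrow> bool" where
  "ordinary_point I m F P \<longleftrightarrow> isolated_singularity I F P \<and>
     (\<exists>j\<in>I. \<exists>x\<in>P. x j = 1 \<and>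
        multiplicity_at_0 (local_equation j x F) = m \<and>
        smooth_hypersurface (I - {j}) m (tangent_cone (local_equation j x F)))"

definition node :: "'i set \<Rightarrow> 'i cpoly \<Rightarrow> ('i \<Rightarrow> complex) set \<Rightarrow> bool" where
  "node I F P \<longleftrightarrow> ordinary_point I 2 F P"

text \<open>
  The hypersurface \<open>F = 0\<close> as a point of the projective space of all forms of degree \<open>d\<close>, whose
  homogeneous coordinates are the coefficients of \<open>F\<close>, indexed by \<open>monoms {..n} d\<close>.
\<close>

definition hypersurface_point :: "'i cpoly \<Rightarrow> ('i monom \<Rightarrow> complex) set" where
  "hypersurface_point F = proj_point (Poly_Mapping.lookup F)"

definition severi :: "nat \<Rightarrow> nat \<Rightarrow> nat \<Rightarrow> (nat monom \<Rightarrow> complex) set set" where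
  "severi n d \<delta> = {hypersurface_point F | F. F \<in> forms {..n} d \<and> F \<noteq> 0 \<and>
     finite (sing_locus {..n} F) \<and> card (sing_locus {..n} F) = \<delta> \<and>
     (\<forall>P\<in>sing_locus {..n} F. node {..n} F P)}"

definition delta :: "nat \<Rightarrow> nat \<Rightarrow> nat cpoly \<Rightarrow> nat" where
  "delta n d F = (GREATEST \<delta>.
     hypersurface_point F \<in> zariski_closure (monoms {..n} d) (severi n d \<delta>))"

end

theory Submission
  imports Defs "HOL-Computational_Algebra.Polynomial" "HOL-Library.FuncSet"
begin

text \<open>
  Take for \<open>X\<close> a diagonal hypersurface: in affine coordinates its equation is
  \<open>\<Sum>i. s ^ i * u (x i) = 0\<close> with \<open>u\<close> a univariate polynomial of degree \<open>d\<close> that has an \<open>m\<close>-fold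
  root at \<open>0\<close> and only simple roots elsewhere. Its singular points are the points whose coordinates are
  critical points of \<open>u\<close> and whose critical values, weighted by the \<open>s ^ i\<close>, add up to \<open>0\<close>. For all
  but finitely many \<open>s\<close> this happens only if all these critical values vanish, that is, if all
  coordinates are multiple roots of \<open>u\<close> (\<open>finite_nongeneric_powers\<close>, \<open>sing_locus_diagonal_form\<close>).
  At such a point with roots of order \<open>e\<close> the tangent cone is of Fermat type of degree \<open>e\<close>,
  hence smooth (\<open>ordinary_point_diagonal_form\<close>). So \<open>X\<close> has one ordinary \<open>m\<close>-fold point.

  Now let the \<open>m\<close>-fold root break up into \<open>k = m div 2\<close> double roots \<open>t, 2 * t, \<dots>, k * t\<close> and, for
  odd \<open>m\<close>, a simple root. By the same description the resulting hypersurface has the \<open>k ^ n\<close>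
  points with all coordinates among the double roots as its singular points, and they are nodes, for all
  integers \<open>t \<ge> 1\<close> and all but finitely many \<open>s\<close> (\<open>nodal_diagonal_form\<close>). A form on the
  space of hypersurfaces that vanishes on the Severi variety is a polynomial in \<open>s\<close>
  and a polynomial in \<open>t\<close> along this family. It therefore vanishes first for every \<open>s\<close> and then also
  at \<open>t = 0\<close>, that is, at \<open>X\<close>.

  So \<open>X\<close> is a limit of hypersurfaces with \<open>k ^ n\<close> nodes. This bounds \<open>delta\<close>, a maximum over
  natural numbers, from below only once the number of nodes of hypersurfaces of degree \<open>d\<close> is known to
  be bounded (\<open>severi_bound\<close>). In each affine chart the nodes are nondegenerate zeros of a
  square system of polynomials. A bound for the number of such zeros, weaker than that of Bezout's
  theorem, follows from linear algebra (\<open>card_nondegenerate_zeros\<close>): the products of powers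
  of the equations with polynomials separating \<open>N\<close> nondegenerate zeros are linearly independent
  (\<open>nondegenerate_zeros_independent\<close>), and for large \<open>N\<close> they are too many for their degree.
\<close>

section \<open>Evaluation and substitution\<close>

abbreviation lookup where "lookup \<equiv> Poly_Mapping.lookup"
abbreviation keys where "keys \<equiv> Poly_Mapping.keys"
abbreviation single where "single \<equiv> Poly_Mapping.single"

definition mono_eval :: "('i \<Rightarrow> 'b::comm_semiring_1) \<Rightarrow> 'i monom \<Rightarrow> 'b" where
  "mono_eval s a = (\<Prod>i\<in>keys a. s i ^ lookup a i)"

definition vars :: "'i cpoly \<Rightarrow> 'i set" where
  "vars p = (\<Union>a\<in>keys p. keys a)"

lemma mono_eval_superset:
  assumes "finite J" "keys a \<subseteq> J"
  shows "mono_eval s a = (\<Prod>i\<in>J. s i ^ lookup a i)"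
  unfolding mono_eval_def using assms
  by (intro prod.mono_neutral_left) (auto simp: in_keys_iff)

lemma mono_eval_0 [simp]: "mono_eval s 0 = 1"
  by (simp add: mono_eval_def)

lemma mono_eval_single [simp]: "mono_eval s (single i k) = s i ^ k"
  by (cases "k = 0") (auto simp: mono_eval_def)

lemma mono_eval_add: "mono_eval s (a + b) = mono_eval s a * mono_eval s b"
proof -
  let ?J = "keys a \<union> keys b"
  have "mono_eval s (a + b) = (\<Prod>i\<in>?J. s i ^ lookup (a + b) i)"
    by (rule mono_eval_superset) (auto simp: keys_add)
  also have "\<dots> = (\<Prod>i\<in>?J. s i ^ lookup a i) * (\<Prod>i\<in>?J. s i ^ lookup b i)"
    by (simp add: lookup_add power_add prod.distrib)
  also have "\<dots> = mono_eval s a * mono_eval s b"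
    using mono_eval_superset[of ?J a s] mono_eval_superset[of ?J b s] by simp
  finally show ?thesis .
qed

lemma mdegree_superset:
  assumes "finite J" "keys a \<subseteq> J"
  shows "mdegree a = (\<Sum>i\<in>J. lookup a i)"
  unfolding mdegree_def using assms
  by (intro sum.mono_neutral_left) (auto simp: in_keys_iff)

lemma mdegree_add: "mdegree (a + b) = mdegree a + mdegree b"
proof -
  let ?J = "keys a \<union> keys b"
  have "mdegree (a + b) = (\<Sum>i\<in>?J. lookup (a + b) i)"
    by (rule mdegree_superset) (auto simp: keys_add)
  also have "\<dots> = (\<Sum>i\<in>?J. lookup a i) + (\<Sum>i\<in>?J. lookup b i)"
    by (simp add: lookup_add sum.distrib)
  also have "\<dots> = mdegree a + mdegree b"
    using mdegree_superset[of ?J a] mdegree_superset[of ?J b] by simp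
  finally show ?thesis .
qed

lemma mdegree_single [simp]: "mdegree (single i k) = k"
  by (cases "k = 0") (auto simp: mdegree_def)

lemma mdegree_0 [simp]: "mdegree 0 = 0"
  by (simp add: mdegree_def)

lemma lookup_le_mdegree: "lookup a i \<le> mdegree a"
proof (cases "i \<in> keys a")
  case True
  then show ?thesis unfolding mdegree_def by (intro member_le_sum) auto
qed (simp add: in_keys_iff)

lemma mono_eval_scale:
  "mono_eval (\<lambda>i. c * x i) a = c ^ mdegree a * mono_eval x a"
  by (simp add: mono_eval_def mdegree_def power_mult_distrib prod.distrib power_sum)

lemma poly_mapping_sum_single: "(\<Sum>a\<in>keys p. single a (lookup p a)) = p"
proof (rule poly_mapping_eqI)
  fix b
  have "lookup (\<Sum>a\<in>keys p. single a (lookup p a)) b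
      = (\<Sum>a\<in>keys p. if a = b then lookup p a else 0)"
    by (simp add: lookup_sum lookup_single when_def)
  also have "\<dots> = lookup p b"
    by (simp add: sum.delta' in_keys_iff)
  finally show "lookup (\<Sum>a\<in>keys p. single a (lookup p a)) b = lookup p b" .
qed

text \<open>
  Evaluation of polynomials and substitution of polynomials for the variables are the same
  construction over different coefficient homomorphisms, so that both inherit the laws of a ring
  homomorphism from here.
\<close>

locale coeff_hom =
  fixes \<phi> :: "complex \<Rightarrow> 'b::comm_semiring_1"
  assumes hom_0: "\<phi> 0 = 0" and hom_1: "\<phi> 1 = 1"
    and hom_add: "\<phi> (c + d) = \<phi> c + \<phi> d" and hom_mult: "\<phi> (c * d) = \<phi> c * \<phi> d"
begin

lemma eval_alt: "insert_with \<phi> s p = (\<Sum>a\<in>keys p. \<phi> (lookup p a) * mono_eval s a)"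
  by (simp add: insert_with_def mono_eval_def)

lemma eval_single: "insert_with \<phi> s (single a c) = \<phi> c * mono_eval s a"
  by (cases "c = 0") (simp_all add: eval_alt hom_0)

lemma eval_add: "insert_with \<phi> s (p + q) = insert_with \<phi> s p + insert_with \<phi> s q"
  unfolding eval_alt
  by (rule setsum_keys_plus_distrib) (auto simp: hom_0 hom_add distrib_right)

lemma eval_0: "insert_with \<phi> s 0 = 0"
  by (simp add: eval_alt)

lemma eval_sum: "insert_with \<phi> s (sum f A) = (\<Sum>x\<in>A. insert_with \<phi> s (f x))"
  by (induction A rule: infinite_finite_induct) (auto simp: eval_0 eval_add)

lemma eval_mult: "insert_with \<phi> s (p * q) = insert_with \<phi> s p * insert_with \<phi> s q"
proof -
  have "p * q = (\<Sum>a\<in>keys p. single a (lookup p a)) * (\<Sum>b\<in>keys q. single b (lookup q b))"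
    by (simp add: poly_mapping_sum_single)
  also have "\<dots> = (\<Sum>a\<in>keys p. \<Sum>b\<in>keys q. single (a + b) (lookup p a * lookup q b))"
    by (simp add: sum_product mult_single)
  finally have "insert_with \<phi> s (p * q)
      = (\<Sum>a\<in>keys p. \<Sum>b\<in>keys q. (\<phi> (lookup p a) * mono_eval s a) * (\<phi> (lookup q b) * mono_eval s b))"
    by (simp add: eval_sum eval_single hom_mult mono_eval_add mult_ac)
  then show ?thesis by (simp add: eval_alt sum_product)
qed

lemma eval_1: "insert_with \<phi> s 1 = 1"
  using eval_single[of s 0 1] by (simp add: hom_1)

lemma eval_prod: "insert_with \<phi> s (prod f A) = (\<Prod>x\<in>A. insert_with \<phi> s (f x))"
  by (induction A rule: infinite_finite_induct) (auto simp: eval_1 eval_mult)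

lemma eval_power: "insert_with \<phi> s (p ^ k) = insert_with \<phi> s p ^ k"
  by (induction k) (auto simp: eval_1 eval_mult)

end

interpretation peval: coeff_hom "\<lambda>c::complex. c"
  by unfold_locales auto

interpretation psubst: coeff_hom PConst
  by unfold_locales (simp_all add: PConst_def single_add mult_single)

lemmas peval_hom [simp] =
  peval.eval_single[folded peval_def] peval.eval_add[folded peval_def]
  peval.eval_0[folded peval_def] peval.eval_sum[folded peval_def]
  peval.eval_mult[folded peval_def] peval.eval_1[folded peval_def]
  peval.eval_prod[folded peval_def] peval.eval_power[folded peval_def]

lemmas peval_alt = peval.eval_alt[folded peval_def]

lemma peval_uminus [simp]: "peval x (- p) = - peval x p"
  using peval_hom(2)[of x p "- p"] by (simp add: add_eq_0_iff)

lemma peval_diff [simp]: "peval x (p - q) = peval x p - peval x q"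
  using peval_hom(2)[of x p "- q"] by simp

lemma peval_PVar [simp]: "peval x (PVar i) = x i"
  by (simp add: PVar_def)

lemma peval_PConst [simp]: "peval x (PConst c) = c"
  by (simp add: PConst_def)

lemma peval_psubst: "peval y (psubst \<sigma> p) = peval (\<lambda>i. peval y (\<sigma> i)) p"
  by (simp add: psubst_def psubst.eval_alt peval_alt[of "\<lambda>i. peval y (\<sigma> i)"] mono_eval_def)

lemma peval_local_equation:
  "peval y (local_equation j x F) = peval (\<lambda>i. x i + (if i = j then 0 else y i)) F"
proof -
  have "(\<lambda>i. peval y (PConst (x i) + (if i = j then 0 else PVar i)))
      = (\<lambda>i. x i + (if i = j then 0 else y i))"
    by auto
  then show ?thesis by (simp add: local_equation_def peval_psubst)
qed

lemma univariate_coeffs_eq_0: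
  fixes C :: "'a \<Rightarrow> complex"
  assumes "finite A" "\<And>z. (\<Sum>a\<in>A. C a * z ^ e a) = 0"
  shows "(\<Sum>a | a \<in> A \<and> e a = k. C a) = 0"
proof -
  let ?p = "\<Sum>a\<in>A. Polynomial.monom (C a) (e a)"
  have "poly ?p z = 0" for z
    using assms(2)[of z] by (simp add: poly_sum poly_monom)
  then have "coeff ?p k = 0"
    using poly_all_0_iff_0[of ?p] by simp
  then show ?thesis
    using assms(1) by (simp add: coeff_sum sum.If_cases Int_def conj_commute)
qed

text \<open>
  The exponents are functions on \<open>I\<close> rather than monomials so that the induction on the set of
  variables can split off the powers of one variable.
\<close>

lemma coeffs_eq_0:
  fixes c :: "'a \<Rightarrow> complex" and e :: "'a \<Rightarrow> 'i \<Rightarrow> nat"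
  assumes "finite I" "finite A"
    and "\<And>a b. a \<in> A \<Longrightarrow> b \<in> A \<Longrightarrow> (\<forall>i\<in>I. e a i = e b i) \<Longrightarrow> a = b"
    and "\<And>y. (\<Sum>a\<in>A. c a * (\<Prod>i\<in>I. y i ^ e a i)) = 0"
    and "a \<in> A"
  shows "c a = 0"
  using assms
proof (induction I arbitrary: A a rule: finite_induct)
  case empty
  have "A = {a}" using empty.prems(2,4) by fastforce
  then show ?case using empty.prems(3) by simp
next
  case (insert j I)
  let ?B = "{b \<in> A. e b j = e a j}"
  show ?case
  proof (rule insert.IH[of ?B])
    show "finite ?B" "a \<in> ?B" using insert.prems by auto
    show "b = b'" if "b \<in> ?B" "b' \<in> ?B" "\<forall>i\<in>I. e b i = e b' i" for b b'
      using that by (intro insert.prems(2)) auto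
    fix y
    have "(\<Sum>b\<in>A. (c b * (\<Prod>i\<in>I. y i ^ e b i)) * z ^ e b j) = 0" for z
    proof -
      have "(\<Prod>i\<in>insert j I. (y(j := z)) i ^ e b i) = z ^ e b j * (\<Prod>i\<in>I. y i ^ e b i)" for b
      proof -
        have "(\<Prod>i\<in>I. (y(j := z)) i ^ e b i) = (\<Prod>i\<in>I. y i ^ e b i)"
          using insert.hyps by (intro prod.cong) auto
        then show ?thesis using insert.hyps by simp
      qed
      then show ?thesis using insert.prems(3)[of "y(j := z)"] by (simp add: mult_ac)
    qed
    from univariate_coeffs_eq_0[OF \<open>finite A\<close> this, of "e a j"]
    show "(\<Sum>b\<in>?B. c b * (\<Prod>i\<in>I. y i ^ e b i)) = 0" .
  qed
qed

lemma finite_vars [simp]: "finite (vars p)"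
  by (simp add: vars_def)

lemma peval_eq_0_imp_0:
  assumes "\<And>y. peval y p = 0"
  shows "p = 0"
proof (rule ccontr)
  assume "p \<noteq> 0"
  then obtain a where a: "a \<in> keys p" by (metis keys_eq_empty all_not_in_conv)
  have "lookup p a = 0"
  proof (rule coeffs_eq_0[where I = "vars p" and A = "keys p" and e = lookup and c = "lookup p"])
    show "b = b'" if "b \<in> keys p" "b' \<in> keys p" "\<forall>i\<in>vars p. lookup b i = lookup b' i" for b b'
    proof (rule poly_mapping_eqI)
      fix i show "lookup b i = lookup b' i"
        using that by (cases "i \<in> vars p") (force simp: vars_def in_keys_iff)+
    qed
    show "(\<Sum>b\<in>keys p. lookup p b * (\<Prod>i\<in>vars p. y i ^ lookup b i)) = 0" for y
    proof -
      have "(\<Prod>i\<in>vars p. y i ^ lookup b i) = mono_eval y b" if "b \<in> keys p" for b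
        using that by (subst mono_eval_superset[of "vars p"]) (auto simp: vars_def)
      then show ?thesis using assms[of y] by (simp add: peval_alt)
    qed
  qed (use a in auto)
  then show False using a by (simp add: in_keys_iff)
qed

lemma peval_inject:
  assumes "\<And>y. peval y p = peval y q"
  shows "p = q"
  using peval_eq_0_imp_0[of "p - q"] assms by simp

section \<open>Partial derivatives and homogeneous components\<close>

lemma peval_partial:
  "peval x (partial i p) =
     (\<Sum>a\<in>keys p. of_nat (lookup a i) * lookup p a * mono_eval x (a - single i 1))"
  by (simp add: partial_def)

lemma mono_eval_has_field_derivative:
  fixes x :: "'i \<Rightarrow> complex \<Rightarrow> complex"
  assumes I: "finite I" "keys a \<subseteq> I"
    and x: "\<And>i. i \<in> I \<Longrightarrow> (x i has_field_derivative x' i) (at t)"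
  shows "((\<lambda>t. mono_eval (\<lambda>i. x i t) a) has_field_derivative
           (\<Sum>i\<in>I. of_nat (lookup a i) * mono_eval (\<lambda>i. x i t) (a - single i 1) * x' i)) (at t)"
proof -
  have "((\<lambda>t. \<Prod>i\<in>I. x i t ^ lookup a i) has_field_derivative
      (\<Sum>i\<in>I. of_nat (lookup a i) * (x' i * x i t ^ (lookup a i - Suc 0)) * (\<Prod>k\<in>I - {i}. x k t ^ lookup a k)))
      (at t)"
    by (rule has_field_derivative_prod) (rule DERIV_power, rule x)
  moreover have "of_nat (lookup a i) * (x' i * x i t ^ (lookup a i - Suc 0)) * (\<Prod>k\<in>I - {i}. x k t ^ lookup a k)
      = of_nat (lookup a i) * mono_eval (\<lambda>i. x i t) (a - single i 1) * x' i" if i: "i \<in> I" for i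
  proof -
    have "mono_eval (\<lambda>i. x i t) (a - single i 1) = (\<Prod>k\<in>I. x k t ^ lookup (a - single i 1) k)"
      using I by (intro mono_eval_superset) (auto simp: in_keys_iff lookup_minus)
    also have "\<dots> = x i t ^ (lookup a i - 1) * (\<Prod>k\<in>I - {i}. x k t ^ lookup (a - single i 1) k)"
      using i I by (subst prod.remove[of I i]) (auto simp: lookup_minus)
    also have "(\<Prod>k\<in>I - {i}. x k t ^ lookup (a - single i 1) k) = (\<Prod>k\<in>I - {i}. x k t ^ lookup a k)"
      by (intro prod.cong) (auto simp: lookup_minus lookup_single when_def)
    finally show ?thesis by simp
  qed
  ultimately show ?thesis
    using I by (simp add: mono_eval_superset[of I a])
qed

text \<open>
  Derivatives of functions are unique. By this chain rule, a formula for the values of a polynomial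
  along a curve therefore determines the values of its formal partial derivatives.
\<close>

lemma peval_has_field_derivative:
  fixes x :: "'i \<Rightarrow> complex \<Rightarrow> complex"
  assumes I: "finite I" "vars p \<subseteq> I"
    and x: "\<And>i. i \<in> I \<Longrightarrow> (x i has_field_derivative x' i) (at t)"
  shows "((\<lambda>t. peval (\<lambda>i. x i t) p) has_field_derivative
           (\<Sum>i\<in>I. peval (\<lambda>i. x i t) (partial i p) * x' i)) (at t)"
proof -
  have "((\<lambda>t. peval (\<lambda>i. x i t) p) has_field_derivative (\<Sum>a\<in>keys p. lookup p a *
      (\<Sum>i\<in>I. of_nat (lookup a i) * mono_eval (\<lambda>i. x i t) (a - single i 1) * x' i))) (at t)"
    unfolding peval_alt using I(2)
    by (intro DERIV_sum DERIV_cmult mono_eval_has_field_derivative I(1) x) (auto simp: vars_def)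
  also have "(\<Sum>a\<in>keys p. lookup p a *
      (\<Sum>i\<in>I. of_nat (lookup a i) * mono_eval (\<lambda>i. x i t) (a - single i 1) * x' i))
      = (\<Sum>i\<in>I. peval (\<lambda>i. x i t) (partial i p) * x' i)"
    by (simp add: peval_partial sum_distrib_left sum_distrib_right sum.swap[of _ "keys p"] mult_ac)
  finally show ?thesis .
qed

lemma peval_partial_has_field_derivative:
  "((\<lambda>t. peval (y(i := t)) p) has_field_derivative peval (y(i := s)) (partial i p)) (at s)"
proof -
  let ?I = "insert i (vars p)"
  have "((\<lambda>t. peval (\<lambda>k. (if k = i then (\<lambda>t. t) else (\<lambda>t. y k)) t) p) has_field_derivative
      (\<Sum>k\<in>?I. peval (\<lambda>k. (if k = i then (\<lambda>t. t) else (\<lambda>t. y k)) s) (partial k p) * (if k = i then 1 else 0)))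
      (at s)"
    by (rule peval_has_field_derivative) auto
  moreover have "(\<lambda>k. (if k = i then (\<lambda>t. t) else (\<lambda>t. y k)) t) = y(i := t)" for t
    by auto
  ultimately show ?thesis by (simp add: if_distrib[of "\<lambda>z. _ * z"] sum.delta cong: if_cong)
qed

lemma lookup_hom_component:
  "lookup (hom_component k p) a = (if mdegree a = k then lookup p a else 0)"
proof -
  have "lookup (hom_component k p) a
      = (\<Sum>b | b \<in> keys p \<and> mdegree b = k. if b = a then lookup p b else 0)"
    by (simp add: hom_component_def lookup_sum lookup_single when_def)
  also have "\<dots> = (if mdegree a = k then lookup p a else 0)"
    by (simp add: sum.delta' in_keys_iff)
  finally show ?thesis .
qed

lemma lookup_partial:
  "lookup (partial i p) b = of_nat (lookup b i + 1) * lookup p (b + single i 1)"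
proof -
  have *: "a - single i 1 = b \<longleftrightarrow> a = b + single i 1" if "lookup a i \<noteq> 0" for a
  proof -
    have "lookup a k - lookup (single i 1) k = lookup b k \<longleftrightarrow> lookup a k = lookup b k + lookup (single i 1) k" for k
      using that by (auto simp: lookup_single when_def)
    then show ?thesis by (simp add: poly_mapping_eq_iff fun_eq_iff lookup_minus lookup_add)
  qed
  have "lookup (partial i p) b
      = (\<Sum>a\<in>keys p. if a - single i 1 = b then of_nat (lookup a i) * lookup p a else 0)"
    by (simp add: partial_def lookup_sum lookup_single when_def)
  also have "\<dots> = (\<Sum>a\<in>keys p. if a = b + single i 1 then of_nat (lookup a i) * lookup p a else 0)"
    using * by (intro sum.cong) auto
  also have "\<dots> = of_nat (lookup b i + 1) * lookup p (b + single i 1)"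
    by (simp add: sum.delta' in_keys_iff lookup_add)
  finally show ?thesis .
qed

lemma hom_component_partial:
  "hom_component k (partial i p) = partial i (hom_component (Suc k) p)"
  by (rule poly_mapping_eqI) (auto simp: lookup_hom_component lookup_partial mdegree_add)

lemma vars_partial: "vars (partial i p) \<subseteq> vars p"
proof -
  have "k \<in> vars p" if "b \<in> keys (partial i p)" "k \<in> keys b" for b k
  proof -
    have "b + single i 1 \<in> keys p" using that(1) by (auto simp: in_keys_iff lookup_partial)
    moreover have "k \<in> keys (b + single i 1)" using that(2) by (auto simp: in_keys_iff lookup_add)
    ultimately show ?thesis by (auto simp: vars_def)
  qed
  then show ?thesis by (auto simp: vars_def)
qed

lemma forms_iff: "F \<in> forms I d \<longleftrightarrow> (\<forall>a\<in>keys F. keys a \<subseteq> I \<and> mdegree a = d)"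
  by (auto simp: forms_def monoms_def)

lemma forms_vars: "F \<in> forms I d \<Longrightarrow> vars F \<subseteq> I"
  by (auto simp: forms_iff vars_def)

lemma forms_partial: "F \<in> forms I d \<Longrightarrow> partial i F \<in> forms I (d - 1)"
proof -
  assume F: "F \<in> forms I d"
  have "keys b \<subseteq> I \<and> mdegree b = d - 1" if "b \<in> keys (partial i F)" for b
  proof -
    have "b + single i 1 \<in> keys F" using that by (auto simp: in_keys_iff lookup_partial)
    then have "keys (b + single i 1) \<subseteq> I" "mdegree (b + single i 1) = d"
      using F by (auto simp: forms_iff)
    moreover have "keys b \<subseteq> keys (b + single i 1)" by (auto simp: in_keys_iff lookup_add)
    ultimately show ?thesis by (auto simp: mdegree_add)
  qed
  then show ?thesis by (auto simp: forms_iff)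
qed

lemma forms_scale:
  assumes "F \<in> forms I d"
  shows "peval (\<lambda>i. c * x i) F = c ^ d * peval x F"
  using assms by (simp add: peval_alt mono_eval_scale forms_iff sum_distrib_left mult_ac)

lemma forms_Euler:
  assumes I: "finite I" and F: "F \<in> forms I d"
  shows "of_nat d * peval x F = (\<Sum>i\<in>I. x i * peval x (partial i F))"
proof -
  have 1: "((\<lambda>t. peval (\<lambda>i. t * x i) F) has_field_derivative
      (\<Sum>i\<in>I. peval (\<lambda>i. 1 * x i) (partial i F) * x i)) (at 1)"
    by (rule peval_has_field_derivative[OF I forms_vars[OF F]]) (auto intro!: derivative_eq_intros)
  have 2: "((\<lambda>t. t ^ d * peval x F) has_field_derivative of_nat d * peval x F) (at 1)"
    by (auto intro!: derivative_eq_intros)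
  from DERIV_unique[OF 1[unfolded forms_scale[OF F]] 2]
  show ?thesis by (simp add: mult.commute)
qed

text \<open>
  Together with \<open>hom_component_partial\<close> this expresses a quadratic tangent cone by second derivatives.
\<close>

lemma hom_component_1_has_field_derivative:
  "((\<lambda>t. peval (\<lambda>i. t * y i) p) has_field_derivative peval y (hom_component 1 p)) (at 0)"
proof -
  have "((\<lambda>t. \<Sum>a\<in>keys p. lookup p a * (t ^ mdegree a * mono_eval y a)) has_field_derivative
      (\<Sum>a\<in>keys p. lookup p a * (of_nat (mdegree a) * 0 ^ (mdegree a - 1) * mono_eval y a))) (at 0)"
    by (auto intro!: derivative_eq_intros DERIV_sum simp: mult_ac)
  moreover have "(\<Sum>a\<in>keys p. lookup p a * (of_nat (mdegree a) * 0 ^ (mdegree a - 1) * mono_eval y a))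
      = peval y (hom_component 1 p)"
  proof -
    have "peval y (hom_component 1 p) = (\<Sum>a | a \<in> keys p \<and> mdegree a = 1. lookup p a * mono_eval y a)"
      by (simp add: hom_component_def)
    also have "\<dots> = (\<Sum>a\<in>keys p. if mdegree a = 1 then lookup p a * mono_eval y a else 0)"
      by (simp add: sum.If_cases Int_def)
    also have "\<dots> = (\<Sum>a\<in>keys p. lookup p a * (of_nat (mdegree a) * 0 ^ (mdegree a - 1) * mono_eval y a))"
      by (intro sum.cong) (auto simp: power_0_left)
    finally show ?thesis by simp
  qed
  ultimately show ?thesis by (simp add: peval_alt mono_eval_scale)
qed

section \<open>Counting nondegenerate zeros\<close>

lemma underdetermined_system:
  fixes M :: "'a \<Rightarrow> 'b \<Rightarrow> complex"
  assumes "finite B" "finite A" "card B < card A"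
  shows "\<exists>v. (\<exists>a\<in>A. v a \<noteq> 0) \<and> (\<forall>b\<in>B. (\<Sum>a\<in>A. v a * M a b) = 0)"
  using assms
proof (induction B arbitrary: A M rule: finite_induct)
  case empty
  then have "A \<noteq> {}" by auto
  then show ?case by (intro exI[of _ "\<lambda>_. 1"]) auto
next
  case (insert b B)
  show ?case
  proof (cases "\<forall>a\<in>A. M a b = 0")
    case True
    with insert.IH[of A M] insert.prems insert.hyps show ?thesis by auto
  next
    case False
    then obtain a0 where a0: "a0 \<in> A" "M a0 b \<noteq> 0" by auto
    let ?M = "\<lambda>a c. M a c - M a b / M a0 b * M a0 c"
    have "card B < card (A - {a0})" using insert.prems insert.hyps a0 by simp
    with insert.IH[of "A - {a0}" ?M] insert.prems obtain v a where
      a: "a \<in> A - {a0}" "v a \<noteq> 0" and v: "\<forall>c\<in>B. (\<Sum>a\<in>A - {a0}. v a * ?M a c) = 0"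
      by auto
    \<comment> \<open>The value at \<open>a0\<close> solves the equation \<open>b\<close>; it was eliminated from the other equations.\<close>
    define v' where "v' = v(a0 := - (\<Sum>a\<in>A - {a0}. v a * M a b) / M a0 b)"
    have sum: "(\<Sum>a\<in>A. v' a * M a c) = v' a0 * M a0 c + (\<Sum>a\<in>A - {a0}. v a * M a c)" for c
      using a0 insert.prems by (subst sum.remove[of A a0]) (auto simp: v'_def)
    have "(\<Sum>a\<in>A. v' a * M a c) = 0" if "c \<in> insert b B" for c
    proof (cases "c = b")
      case True
      have "v' a0 * M a0 b = - (\<Sum>a\<in>A - {a0}. v a * M a b)" using a0 by (simp add: v'_def)
      then show ?thesis unfolding True sum by simp
    next
      case False
      with that v have "(\<Sum>a\<in>A - {a0}. v a * ?M a c) = 0" by auto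
      moreover have "(\<Sum>a\<in>A - {a0}. v a * ?M a c)
          = (\<Sum>a\<in>A - {a0}. v a * M a c) - (\<Sum>a\<in>A - {a0}. v a * M a b) / M a0 b * M a0 c"
        by (simp add: right_diff_distrib sum_subtractf sum_distrib_right sum_divide_distrib mult.assoc)
      ultimately show ?thesis unfolding sum by (simp add: v'_def)
    qed
    moreover have "v' a \<noteq> 0" using a by (auto simp: v'_def)
    ultimately show ?thesis using a by blast
  qed
qed

text \<open>
  Adjoining the right hand side as a further unknown gives a homogeneous system with more unknowns than
  equations, and injectivity makes the new unknown nonzero in every nontrivial solution.
\<close>

lemma injective_imp_solvable:
  fixes L :: "'i \<Rightarrow> 'i \<Rightarrow> complex"
  assumes I: "finite I"
    and inj: "\<And>y. (\<And>i. i \<in> I \<Longrightarrow> (\<Sum>k\<in>I. L i k * y k) = 0) \<Longrightarrow> (\<forall>k\<in>I. y k = 0)"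
  shows "\<exists>y. \<forall>i\<in>I. (\<Sum>k\<in>I. L i k * y k) = w i"
proof -
  let ?A = "insert None (Some ` I)"
  have sum: "(\<Sum>a\<in>?A. h a) = h None + (\<Sum>k\<in>I. h (Some k))" for h :: "'i option \<Rightarrow> complex"
    using I by (simp add: sum.reindex)
  have "card ?A = Suc (card I)" using I by (simp add: card_image)
  then obtain v a where v: "a \<in> ?A" "v a \<noteq> 0" and
    eq: "\<forall>i\<in>I. (\<Sum>a\<in>?A. v a * (case a of None \<Rightarrow> - w i | Some k \<Rightarrow> L i k)) = 0"
    using underdetermined_system[of I ?A "\<lambda>a i. case a of None \<Rightarrow> - w i | Some k \<Rightarrow> L i k"] I
    by auto
  have eq': "(\<Sum>k\<in>I. L i k * v (Some k)) = v None * w i" if "i \<in> I" for i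
    using eq that by (simp add: sum mult.commute add_eq_0_iff)
  have "v None \<noteq> 0"
  proof
    assume "v None = 0"
    then have "\<forall>k\<in>I. v (Some k) = 0" using eq' by (intro inj) auto
    with v \<open>v None = 0\<close> show False by auto
  qed
  then have "(\<Sum>k\<in>I. L i k * (v (Some k) / v None)) = w i" if "i \<in> I" for i
    using eq'[OF that] by (simp flip: sum_divide_distrib)
  then show ?thesis by (intro exI[of _ "\<lambda>k. v (Some k) / v None"]) simp
qed

text \<open>
  The degree is bounded in each variable separately: the monomials then form a box, which is
  easier to count than the monomials of bounded total degree.
\<close>

definition box_polys :: "'i set \<Rightarrow> nat \<Rightarrow> 'i cpoly set" where
  "box_polys I D = {p. \<forall>a\<in>keys p. keys a \<subseteq> I \<and> (\<forall>i. lookup a i \<le> D)}"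

lemma box_polys_mono: "p \<in> box_polys I D \<Longrightarrow> D \<le> E \<Longrightarrow> p \<in> box_polys I E"
proof -
  assume p: "p \<in> box_polys I D" and "D \<le> E"
  have "lookup a i \<le> E" if "a \<in> keys p" for a i
  proof -
    have "lookup a i \<le> D" using p that by (simp add: box_polys_def)
    with \<open>D \<le> E\<close> show ?thesis by linarith
  qed
  with p show ?thesis by (simp add: box_polys_def)
qed

lemma box_polys_vars: "p \<in> box_polys I D \<Longrightarrow> vars p \<subseteq> I"
  by (auto simp: box_polys_def vars_def)

lemma box_polys_1: "1 \<in> box_polys I 0"
  by (simp add: box_polys_def)

lemma box_polys_mult:
  assumes "p \<in> box_polys I D" "q \<in> box_polys I E"
  shows "p * q \<in> box_polys I (D + E)"
proof -
  have "keys c \<subseteq> I \<and> (\<forall>i. lookup c i \<le> D + E)" if "c \<in> keys (p * q)" for c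
  proof -
    obtain a b where c: "c = a + b" "a \<in> keys p" "b \<in> keys q"
      using \<open>c \<in> keys (p * q)\<close> keys_mult by blast
    then have "keys a \<subseteq> I" "keys b \<subseteq> I" "lookup a i \<le> D" "lookup b i \<le> E" for i
      using assms by (auto simp: box_polys_def)
    then show ?thesis using keys_add[of a b] by (auto simp: c(1) lookup_add intro!: add_mono)
  qed
  then show ?thesis by (simp add: box_polys_def)
qed

lemma box_polys_prod:
  assumes "\<And>x. x \<in> A \<Longrightarrow> p x \<in> box_polys I (D x)"
  shows "(\<Prod>x\<in>A. p x) \<in> box_polys I (\<Sum>x\<in>A. D x)"
  using assms by (induction A rule: infinite_finite_induct) (auto simp: box_polys_1 box_polys_mult)

lemma box_polys_power: "p \<in> box_polys I D \<Longrightarrow> p ^ k \<in> box_polys I (D * k)"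
  by (induction k) (auto simp: box_polys_1 box_polys_mult)

lemma box_polys_affine: "i \<in> I \<Longrightarrow> PVar i - PConst c \<in> box_polys I 1"
proof -
  assume "i \<in> I"
  moreover have "keys (PVar i - PConst c) \<subseteq> {single i 1, 0}"
    using keys_diff[of "PVar i" "PConst c"] by (auto simp: PVar_def PConst_def split: if_splits)
  ultimately show ?thesis
    by (fastforce simp: box_polys_def lookup_single when_def)
qed

lemma lookup_PConst_mult: "lookup (PConst c * p) b = c * lookup p b"
proof -
  have "PConst c * p = PConst c * (\<Sum>a\<in>keys p. single a (lookup p a))"
    by (simp only: poly_mapping_sum_single)
  also have "\<dots> = (\<Sum>a\<in>keys p. single a (c * lookup p a))"
    by (simp add: PConst_def sum_distrib_left mult_single)
  finally have "lookup (PConst c * p) b = (\<Sum>a\<in>keys p. if a = b then c * lookup p a else 0)"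
    by (simp add: lookup_sum lookup_single when_def)
  also have "\<dots> = c * lookup p b"
    by (simp add: sum.delta' in_keys_iff)
  finally show ?thesis .
qed

lemma forms_box_polys: "F \<in> forms I d \<Longrightarrow> F \<in> box_polys I d"
  by (auto simp: forms_iff box_polys_def lookup_le_mdegree)

lemma box_monomials:
  assumes "finite I"
  shows "finite {a :: 'i monom. keys a \<subseteq> I \<and> (\<forall>i. lookup a i \<le> D)}" (is "finite ?B")
    and "card {a :: 'i monom. keys a \<subseteq> I \<and> (\<forall>i. lookup a i \<le> D)} \<le> (D + 1) ^ card I"
proof -
  let ?h = "\<lambda>a :: 'i monom. restrict (lookup a) I"
  have inj: "inj_on ?h ?B"
  proof (rule inj_onI, rule poly_mapping_eqI)
    fix a b i assume a: "a \<in> ?B" and b: "b \<in> ?B" and h: "?h a = ?h b"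
    show "lookup a i = lookup b i"
    proof (cases "i \<in> I")
      case True
      then show ?thesis using fun_cong[OF h, of i] by (simp add: restrict_def)
    next
      case False
      then have "i \<notin> keys a" "i \<notin> keys b" using a b by blast+
      then show ?thesis by (simp add: in_keys_iff)
    qed
  qed
  have im: "?h ` ?B \<subseteq> PiE I (\<lambda>_. {..D})" by auto
  have fin: "finite (PiE I (\<lambda>_. {..D}))" using assms by (intro finite_PiE) auto
  show "finite ?B" using inj_on_finite[OF inj im fin] .
  have "card ?B \<le> card (PiE I (\<lambda>_. {..D}))" using card_inj_on_le[OF inj im fin] .
  then show "card ?B \<le> (D + 1) ^ card I" using assms by (simp add: card_PiE)
qed

text \<open>
  To lowest order at a zero \<open>Q\<close>, a combination of products of powers of the \<open>f i\<close> with the \<open>g P\<close>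
  is a form in the linear parts of the \<open>f i\<close>, to which only \<open>g Q\<close> contributes. These
  linear parts are linear coordinates since \<open>Q\<close> is nondegenerate. So the coefficients of
  lowest order vanish if the combination does.
\<close>

lemma nondegenerate_zeros_independent:
  fixes f :: "'i \<Rightarrow> 'i cpoly" and Z :: "('i \<Rightarrow> complex) set" and E :: "('i \<Rightarrow> nat) set"
  assumes I: "finite I" and Z: "finite Z" and E: "finite E" "E \<subseteq> extensional I"
    and vars: "\<And>i. i \<in> I \<Longrightarrow> vars (f i) \<subseteq> I"
    and zero: "\<And>x i. x \<in> Z \<Longrightarrow> i \<in> I \<Longrightarrow> peval x (f i) = 0"
    and nondeg: "\<And>x y. x \<in> Z \<Longrightarrow>
      (\<And>i. i \<in> I \<Longrightarrow> (\<Sum>k\<in>I. peval x (partial k (f i)) * y k) = 0) \<Longrightarrow> (\<forall>k\<in>I. y k = 0)"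
    and g: "\<And>P Q. P \<in> Z \<Longrightarrow> Q \<in> Z \<Longrightarrow> peval Q (g P) = 0 \<longleftrightarrow> P \<noteq> Q"
    and dep: "\<And>x. (\<Sum>P\<in>Z. \<Sum>a\<in>E. v P a * peval x (g P) * (\<Prod>i\<in>I. peval x (f i) ^ a i)) = 0"
  shows "\<forall>P\<in>Z. \<forall>a\<in>E. v P a = 0"
proof (rule ccontr)
  let ?N = "\<lambda>a :: 'i \<Rightarrow> nat. \<Sum>i\<in>I. a i"
  assume "\<not> ?thesis"
  then have "\<exists>k P a. P \<in> Z \<and> a \<in> E \<and> v P a \<noteq> 0 \<and> ?N a = k" by auto
  from exists_least_iff[THEN iffD1, OF this] obtain \<tau> Q b where
    b: "Q \<in> Z" "b \<in> E" "v Q b \<noteq> 0" "?N b = \<tau>" and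
    least: "\<And>P a. P \<in> Z \<Longrightarrow> a \<in> E \<Longrightarrow> v P a \<noteq> 0 \<Longrightarrow> \<tau> \<le> ?N a"
    by (metis not_le)
  have "(\<Sum>a | a \<in> E \<and> ?N a = \<tau>. v Q a * (\<Prod>i\<in>I. w i ^ a i)) = 0" for w
  proof -
    have "\<exists>y. \<forall>i\<in>I. (\<Sum>k\<in>I. peval Q (partial k (f i)) * y k) = w i"
      by (rule injective_imp_solvable[OF I nondeg[OF b(1)]])
    then obtain y where y: "\<And>i. i \<in> I \<Longrightarrow> (\<Sum>k\<in>I. peval Q (partial k (f i)) * y k) = w i"
      by blast
    define line where "line t = (\<lambda>k. Q k + t * y k)" for t
    have line_0: "line 0 = Q" by (simp add: line_def)
    have deriv: "((\<lambda>t. peval (line t) p) has_field_derivative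
        (\<Sum>k\<in>J. peval Q (partial k p) * y k)) (at 0)" if "finite J" "vars p \<subseteq> J" for p J
    proof -
      have "((\<lambda>t. peval (\<lambda>k. Q k + t * y k) p) has_field_derivative
          (\<Sum>k\<in>J. peval (\<lambda>k. Q k + 0 * y k) (partial k p) * y k)) (at 0)"
        by (rule peval_has_field_derivative[OF that]) (auto intro!: derivative_eq_intros)
      then show ?thesis by (simp add: line_def)
    qed
    have lim_f: "((\<lambda>t. peval (line t) (f i) / t) \<longlongrightarrow> w i) (at 0)" if "i \<in> I" for i
      using deriv[OF I vars[OF that]] zero[OF b(1) that] y[OF that]
      by (simp add: has_field_derivative_iff line_0)
    have lim_g: "((\<lambda>t. peval (line t) (g P)) \<longlongrightarrow> peval Q (g P)) (at 0)" for P
      using DERIV_isCont[OF deriv[OF finite_vars order_refl]]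
      by (simp add: isCont_def line_0)
    define S where "S t = (\<Sum>P\<in>Z. \<Sum>a\<in>E. v P a * peval (line t) (g P) *
        (\<Prod>i\<in>I. (peval (line t) (f i) / t) ^ a i) * t ^ (?N a - \<tau>))" for t
    have "S t = 0" if "t \<noteq> 0" for t
    proof -
      have "v P a * peval (line t) (g P) * (\<Prod>i\<in>I. (peval (line t) (f i) / t) ^ a i) * t ^ (?N a - \<tau>)
          = v P a * peval (line t) (g P) * (\<Prod>i\<in>I. peval (line t) (f i) ^ a i) / t ^ \<tau>"
        if "P \<in> Z" "a \<in> E" for P a
      proof (cases "v P a = 0")
        case False
        then have "?N a = \<tau> + (?N a - \<tau>)" using least that by simp
        then have "t ^ ?N a = t ^ \<tau> * t ^ (?N a - \<tau>)" by (metis power_add)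
        then show ?thesis using \<open>t \<noteq> 0\<close>
          by (simp add: power_divide prod_dividef flip: power_sum)
      qed simp
      then have "S t = (\<Sum>P\<in>Z. \<Sum>a\<in>E. v P a * peval (line t) (g P) *
          (\<Prod>i\<in>I. peval (line t) (f i) ^ a i)) / t ^ \<tau>"
        by (simp add: S_def sum_divide_distrib)
      then show ?thesis by (simp add: dep)
    qed
    then have "(S \<longlongrightarrow> 0) (at 0)"
      by (intro tendsto_eventually) (auto simp: eventually_at intro!: exI[of _ 1])
    moreover have "(S \<longlongrightarrow> (\<Sum>P\<in>Z. \<Sum>a\<in>E. v P a * peval Q (g P) *
        (\<Prod>i\<in>I. w i ^ a i) * 0 ^ (?N a - \<tau>))) (at 0)"
      unfolding S_def
      by (intro tendsto_sum tendsto_mult tendsto_prod tendsto_power tendsto_const tendsto_ident_at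
          lim_f lim_g)
    ultimately have "0 = (\<Sum>P\<in>Z. \<Sum>a\<in>E. v P a * peval Q (g P) *
        (\<Prod>i\<in>I. w i ^ a i) * 0 ^ (?N a - \<tau>))"
      by (rule LIM_unique)
    also have "\<dots> = (\<Sum>P\<in>Z. if P = Q then \<Sum>a\<in>E. v P a * peval Q (g P) *
        (\<Prod>i\<in>I. w i ^ a i) * 0 ^ (?N a - \<tau>) else 0)"
    proof (rule sum.cong)
      fix P assume "P \<in> Z"
      then have "peval Q (g P) = 0" if "P \<noteq> Q" using g b(1) that by simp
      then show "(\<Sum>a\<in>E. v P a * peval Q (g P) * (\<Prod>i\<in>I. w i ^ a i) * 0 ^ (?N a - \<tau>))
          = (if P = Q then \<Sum>a\<in>E. v P a * peval Q (g P) * (\<Prod>i\<in>I. w i ^ a i) * 0 ^ (?N a - \<tau>) else 0)"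
        by (cases "P = Q") simp_all
    qed simp
    also have "\<dots> = (\<Sum>a\<in>E. v Q a * peval Q (g Q) * (\<Prod>i\<in>I. w i ^ a i) * 0 ^ (?N a - \<tau>))"
      using Z b(1) by simp
    also have "\<dots> = (\<Sum>a\<in>E. if ?N a = \<tau> then peval Q (g Q) * (v Q a * (\<Prod>i\<in>I. w i ^ a i)) else 0)"
    proof (rule sum.cong)
      fix a assume "a \<in> E"
      then have "v Q a = 0 \<or> ?N a = \<tau> \<or> ?N a > \<tau>" using least[OF b(1)] by force
      then show "v Q a * peval Q (g Q) * (\<Prod>i\<in>I. w i ^ a i) * 0 ^ (?N a - \<tau>)
          = (if ?N a = \<tau> then peval Q (g Q) * (v Q a * (\<Prod>i\<in>I. w i ^ a i)) else 0)"
        by (auto simp: power_0_left)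
    qed simp
    also have "\<dots> = peval Q (g Q) * (\<Sum>a | a \<in> E \<and> ?N a = \<tau>. v Q a * (\<Prod>i\<in>I. w i ^ a i))"
      using E by (simp add: sum.If_cases Int_def sum_distrib_left)
    finally show ?thesis using g b(1) by auto
  qed
  note lowest = this
  have "v Q b = 0"
  proof (rule coeffs_eq_0[OF I, where A = "{a. a \<in> E \<and> ?N a = \<tau>}" and e = "\<lambda>a. a" and c = "v Q"])
    show "a = a'" if "a \<in> {a. a \<in> E \<and> ?N a = \<tau>}" "a' \<in> {a. a \<in> E \<and> ?N a = \<tau>}"
      "\<forall>i\<in>I. a i = a' i" for a a'
      using that E(2) by (intro extensionalityI[of a I a']) blast+
    show "finite {a. a \<in> E \<and> ?N a = \<tau>}" using E(1) by simp
    show "b \<in> {a. a \<in> E \<and> ?N a = \<tau>}" using b(2,4) by blast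
    show "(\<Sum>a | a \<in> E \<and> ?N a = \<tau>. v Q a * (\<Prod>i\<in>I. w i ^ a i)) = 0" for w
      by (rule lowest)
  qed
  with b(3) show False by simp
qed

text \<open>
  A product of linear polynomials, one for each other point, chosen in a coordinate that
  distinguishes the two points.
\<close>

lemma separating_polys:
  fixes Z :: "('i \<Rightarrow> complex) set"
  assumes "finite Z" and supp: "\<And>x i. x \<in> Z \<Longrightarrow> i \<notin> I \<Longrightarrow> x i = 0" and P: "P \<in> Z"
  shows "\<exists>g \<in> box_polys I (card Z). \<forall>Q\<in>Z. peval Q g = 0 \<longleftrightarrow> P \<noteq> Q"
proof -
  have "\<exists>i\<in>I. P i \<noteq> Q i" if "Q \<in> Z" "P \<noteq> Q" for Q
  proof (rule ccontr)
    assume *: "\<not> ?thesis"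
    have "P i = Q i" for i using * supp[OF P, of i] supp[OF that(1), of i] by (cases "i \<in> I") auto
    then show False using that(2) by (simp add: fun_eq_iff)
  qed
  then have "\<forall>Q\<in>Z - {P}. \<exists>i. i \<in> I \<and> P i \<noteq> Q i" by blast
  from bchoice[OF this] obtain \<iota> where \<iota>: "\<forall>Q\<in>Z - {P}. \<iota> Q \<in> I \<and> P (\<iota> Q) \<noteq> Q (\<iota> Q)" ..
  let ?g = "\<Prod>Q\<in>Z - {P}. PVar (\<iota> Q) - PConst (Q (\<iota> Q))"
  have "?g \<in> box_polys I (\<Sum>Q\<in>Z - {P}. 1)"
    using \<iota> by (intro box_polys_prod box_polys_affine) auto
  then have "?g \<in> box_polys I (card Z)"
    by (rule box_polys_mono) (use \<open>finite Z\<close> in \<open>simp add: card_mono\<close>)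
  moreover have "peval Q ?g = 0 \<longleftrightarrow> P \<noteq> Q" if "Q \<in> Z" for Q
  proof -
    have "peval Q ?g = (\<Prod>R\<in>Z - {P}. Q (\<iota> R) - R (\<iota> R))" by simp
    also have "\<dots> = 0 \<longleftrightarrow> (\<exists>R\<in>Z - {P}. Q (\<iota> R) = R (\<iota> R))" using \<open>finite Z\<close> by simp
    also have "\<dots> \<longleftrightarrow> P \<noteq> Q" using \<iota> that by blast
    finally show ?thesis .
  qed
  ultimately show ?thesis by blast
qed

text \<open>
  With \<open>N\<close> zeros, the products of the separating polynomials and of the powers of the \<open>f i\<close> with
  exponents below \<open>N\<close> are \<open>N ^ (r + 1)\<close> independent polynomials, where \<open>r\<close> is the number of
  variables. Their degree in each variable is at most \<open>N * (1 + r * D)\<close>, and such polynomials form a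
  space of dimension at most \<open>(2 + r * D) ^ r * N ^ r\<close>.
\<close>

theorem card_nondegenerate_zeros:
  fixes f :: "'i \<Rightarrow> 'i cpoly"
  assumes I: "finite I" and Z: "finite Z"
    and supp: "\<And>x i. x \<in> Z \<Longrightarrow> i \<notin> I \<Longrightarrow> x i = 0"
    and f: "\<And>i. i \<in> I \<Longrightarrow> f i \<in> box_polys I D"
    and zero: "\<And>x i. x \<in> Z \<Longrightarrow> i \<in> I \<Longrightarrow> peval x (f i) = 0"
    and nondeg: "\<And>x y. x \<in> Z \<Longrightarrow>
      (\<And>i. i \<in> I \<Longrightarrow> (\<Sum>k\<in>I. peval x (partial k (f i)) * y k) = 0) \<Longrightarrow> (\<forall>k\<in>I. y k = 0)"
  shows "card Z \<le> (2 + card I * D) ^ card I"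
proof (rule ccontr)
  let ?N = "card Z" and ?r = "card I"
  assume "\<not> ?thesis"
  then have large: "(2 + ?r * D) ^ ?r < ?N" by simp
  then have pos: "0 < ?N" by simp
  obtain g where g: "\<And>P. P \<in> Z \<Longrightarrow> g P \<in> box_polys I ?N"
    and g_sep: "\<And>P Q. P \<in> Z \<Longrightarrow> Q \<in> Z \<Longrightarrow> peval Q (g P) = 0 \<longleftrightarrow> P \<noteq> Q"
  proof -
    have "\<forall>P\<in>Z. \<exists>g. g \<in> box_polys I ?N \<and> (\<forall>Q\<in>Z. peval Q g = 0 \<longleftrightarrow> P \<noteq> Q)"
    proof
      fix P assume "P \<in> Z"
      have "\<exists>g \<in> box_polys I ?N. \<forall>Q\<in>Z. peval Q g = 0 \<longleftrightarrow> P \<noteq> Q"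
        by (rule separating_polys[OF Z _ \<open>P \<in> Z\<close>], rule supp)
      then show "\<exists>g. g \<in> box_polys I ?N \<and> (\<forall>Q\<in>Z. peval Q g = 0 \<longleftrightarrow> P \<noteq> Q)" by blast
    qed
    from bchoice[OF this] that show ?thesis by blast
  qed
  let ?E = "PiE I (\<lambda>_. {..<?N})"
  define h where "h = (\<lambda>(P, a). g P * (\<Prod>i\<in>I. f i ^ a i))"
  let ?M = "?N + ?r * (D * ?N)"
  let ?B = "{a :: 'i monom. keys a \<subseteq> I \<and> (\<forall>i. lookup a i \<le> ?M)}"
  have E: "finite ?E" "card ?E = ?N ^ ?r"
    using I by (auto simp: card_PiE intro: finite_PiE)
  have h: "h x \<in> box_polys I ?M" if x: "x \<in> Z \<times> ?E" for x
  proof -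
    obtain P a where Pa: "x = (P, a)" "P \<in> Z" "a \<in> ?E" using x by auto
    have "f i ^ a i \<in> box_polys I (D * ?N)" if "i \<in> I" for i
    proof -
      have "a i < ?N" using Pa(3) that by (auto dest: PiE_mem)
      then show ?thesis
        by (intro box_polys_mono[OF box_polys_power[OF f[OF that]]]) simp
    qed
    then have "(\<Prod>i\<in>I. f i ^ a i) \<in> box_polys I (\<Sum>i\<in>I. D * ?N)"
      by (rule box_polys_prod)
    then show ?thesis using box_polys_mult[OF g[OF Pa(2)]] Pa(1) by (simp add: h_def)
  qed
  have "card ?B \<le> (?M + 1) ^ ?r" by (rule box_monomials(2)[OF I])
  also have "\<dots> \<le> (?N * (2 + ?r * D)) ^ ?r"
    using pos by (intro power_mono) (auto simp: algebra_simps)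
  also have "\<dots> = ?N ^ ?r * (2 + ?r * D) ^ ?r" by (rule power_mult_distrib)
  also have "\<dots> < ?N ^ ?r * ?N" using large pos by simp
  also have "\<dots> = card (Z \<times> ?E)" by (simp add: card_cartesian_product E)
  finally have "card ?B < card (Z \<times> ?E)" .
  have "\<exists>v. (\<exists>x\<in>Z \<times> ?E. v x \<noteq> 0) \<and> (\<forall>b\<in>?B. (\<Sum>x\<in>Z \<times> ?E. v x * lookup (h x) b) = 0)"
    by (rule underdetermined_system) (fact box_monomials(1)[OF I] finite_cartesian_product[OF Z E(1)]
        \<open>card ?B < card (Z \<times> ?E)\<close>)+
  then obtain v x where v: "x \<in> Z \<times> ?E" "v x \<noteq> 0"
    and dep: "\<forall>b\<in>?B. (\<Sum>x\<in>Z \<times> ?E. v x * lookup (h x) b) = 0"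
    by (elim exE conjE bexE)
  have "(\<Sum>x\<in>Z \<times> ?E. PConst (v x) * h x) = 0"
  proof (rule poly_mapping_eqI)
    fix b
    have "lookup (\<Sum>x\<in>Z \<times> ?E. PConst (v x) * h x) b = (\<Sum>x\<in>Z \<times> ?E. v x * lookup (h x) b)"
      by (simp only: lookup_sum lookup_PConst_mult)
    also have "\<dots> = 0"
    proof (cases "b \<in> ?B")
      case True
      with dep show ?thesis by blast
    next
      case False
      have "lookup (h x) b = 0" if "x \<in> Z \<times> ?E" for x
      proof -
        have "b \<notin> keys (h x)" using h[OF that] False unfolding box_polys_def by blast
        then show ?thesis by (simp add: in_keys_iff)
      qed
      then show ?thesis by (intro sum.neutral) simp
    qed
    finally show "lookup (\<Sum>x\<in>Z \<times> ?E. PConst (v x) * h x) b = lookup 0 b" by simp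
  qed
  from arg_cong[OF this, of "peval y" for y] have "(\<Sum>x\<in>Z \<times> ?E. v x * peval y (h x)) = 0" for y
    by (simp only: peval_hom peval_PConst)
  then have dep': "(\<Sum>P\<in>Z. \<Sum>a\<in>?E. v (P, a) * peval y (g P) * (\<Prod>i\<in>I. peval y (f i) ^ a i)) = 0" for y
    by (simp add: sum.cartesian_product split_def h_def mult.assoc)
  have "\<forall>P\<in>Z. \<forall>a\<in>?E. v (P, a) = 0"
  proof (rule nondegenerate_zeros_independent[where f = f and g = g and I = I])
    show "vars (f i) \<subseteq> I" if "i \<in> I" for i
      using f[OF that] by (rule box_polys_vars)
    show "?E \<subseteq> extensional I" by (auto simp: PiE_def)
  qed (fact I Z E(1) zero nondeg g_sep dep')+
  with v show False by blast
qed

section \<open>Bounding the number of nodes\<close>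

lemma proj_point_eq:
  assumes "x \<in> proj_point z"
  shows "proj_point x = proj_point z"
proof -
  obtain c where c: "c \<noteq> 0" "x = (\<lambda>i. c * z i)" using assms by (auto simp: proj_point_def)
  have "\<exists>b. y = (\<lambda>i. b * x i) \<and> b \<noteq> 0" if "y = (\<lambda>i. a * z i)" "a \<noteq> 0" for y a
    using that c by (intro exI[of _ "a / c"]) auto
  moreover have "\<exists>b. y = (\<lambda>i. b * z i) \<and> b \<noteq> 0" if "y = (\<lambda>i. a * x i)" "a \<noteq> 0" for y a
    using that c by (intro exI[of _ "a * c"]) auto
  ultimately show ?thesis unfolding proj_point_def by blast
qed

lemma self_in_proj_point: "x \<in> proj_point x"
  unfolding proj_point_def by (intro CollectI exI[of _ 1]) simp

lemma vanishes_at_proj_point: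
  assumes "F \<in> forms I d"
  shows "vanishes_at F (proj_point x) \<longleftrightarrow> peval x F = 0"
proof
  assume "vanishes_at F (proj_point x)"
  then show "peval x F = 0" using self_in_proj_point by (auto simp: vanishes_at_def)
qed (auto simp: vanishes_at_def proj_point_def forms_scale[OF assms])

lemma proj_point_in_sing_locus:
  assumes "F \<in> forms I d"
  shows "proj_point x \<in> sing_locus I F \<longleftrightarrow> proj_point x \<in> proj_space I \<and> peval x F = 0 \<and>
    (\<forall>i\<in>I. peval x (partial i F) = 0)"
  by (simp add: sing_locus_def vanishes_at_proj_point[OF assms]
      vanishes_at_proj_point[OF forms_partial[OF assms]])

lemma proj_space_rep:
  assumes "P \<in> proj_space I" "x \<in> P"
  shows "P = proj_point x" "\<forall>i. i \<notin> I \<longrightarrow> x i = 0"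
proof -
  obtain z where z: "P = proj_point z" "\<forall>i. i \<notin> I \<longrightarrow> z i = 0"
    using assms by (auto simp: proj_space_def)
  then show "P = proj_point x" using assms proj_point_eq by blast
  show "\<forall>i. i \<notin> I \<longrightarrow> x i = 0" using z assms(2) by (auto simp: proj_point_def)
qed

lemma peval_partial_local_equation:
  assumes "i \<noteq> j"
  shows "peval y (partial i (local_equation j x F))
    = peval (\<lambda>k. x k + (if k = j then 0 else y k)) (partial i F)"
proof -
  let ?x = "\<lambda>y k. x k + (if k = j then 0 else y k)"
  have 1: "((\<lambda>t. peval (y(i := t)) (local_equation j x F)) has_field_derivative
      peval y (partial i (local_equation j x F))) (at (y i))"
    using peval_partial_has_field_derivative[of y i "local_equation j x F" "y i"] by simp
  have "((\<lambda>t. peval ((?x y)(i := x i + t)) F) has_field_derivative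
      peval (?x y) (partial i F) * 1) (at (y i))"
  proof (rule DERIV_chain2[where f = "\<lambda>t. peval ((?x y)(i := t)) F" and g = "\<lambda>t. x i + t"])
    show "((\<lambda>t. peval ((?x y)(i := t)) F) has_field_derivative peval (?x y) (partial i F)) (at (x i + y i))"
      using peval_partial_has_field_derivative[of "?x y" i F "x i + y i"] assms
      by (simp add: fun_upd_idem)
  qed (auto intro!: derivative_eq_intros)
  moreover have "(?x y)(i := x i + t) = ?x (y(i := t))" for t
    using assms by auto
  ultimately have 2: "((\<lambda>t. peval (y(i := t)) (local_equation j x F)) has_field_derivative
      peval (?x y) (partial i F)) (at (y i))"
    by (simp add: peval_local_equation)
  from DERIV_unique[OF 1 2] show ?thesis .
qed

lemma partial_affine:
  fixes j k :: 'i
  shows "partial k (PVar j - PConst c) = (if k = j then 1 else 0)"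
proof (rule poly_mapping_eqI)
  fix b :: "'i monom"
  have "b + single k 1 \<noteq> 0"
  proof
    assume "b + single k 1 = 0"
    then have "lookup (b + single k 1) k = 0" by simp
    then show False by (simp add: lookup_add)
  qed
  moreover have "b + single k 1 = single j 1 \<longleftrightarrow> k = j \<and> b = 0"
  proof
    assume b: "b + single k 1 = single j 1"
    then have "lookup (b + single k 1) k = lookup (single j 1) k" by simp
    then have "k = j" by (simp add: lookup_add lookup_single when_def split: if_splits)
    with b show "k = j \<and> b = 0" by simp
  qed simp
  ultimately show "lookup (partial k (PVar j - PConst c)) b = lookup (if k = j then 1 else 0) b"
    by (auto simp: lookup_partial PVar_def PConst_def lookup_minus lookup_single lookup_one when_def)
qed

text \<open>
  The second derivatives of the quadratic tangent cone are those of the affine equation of \<open>F\<close> at \<open>x\<close>,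
  and by Euler's relation a nonzero vector in the kernel of their matrix is a singular point of the quadric.
\<close>

lemma smooth_quadric_nondegenerate:
  assumes I: "finite I" and F: "F \<in> forms I d" and j: "j \<in> I"
    and smooth: "smooth_hypersurface (I - {j}) 2 (hom_component 2 (local_equation j x F))"
    and ker: "\<And>i. i \<in> I - {j} \<Longrightarrow> (\<Sum>k\<in>I - {j}. peval x (partial k (partial i F)) * y k) = 0"
    and k: "k \<in> I - {j}"
  shows "y k = 0"
proof (rule ccontr)
  assume yk: "y k \<noteq> 0"
  let ?f = "local_equation j x F" and ?J = "I - {j}"
  let ?q = "hom_component 2 ?f"
  define z where "z = (\<lambda>i. if i \<in> ?J then y i else 0)"
  have q: "?q \<in> forms ?J 2" using smooth by (simp add: smooth_hypersurface_def)
  have "peval z (partial i ?q) = 0" if i: "i \<in> ?J" for i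
  proof -
    have 1: "((\<lambda>t. peval (\<lambda>k. t * z k) (partial i ?f)) has_field_derivative peval z (partial i ?q)) (at 0)"
      using hom_component_1_has_field_derivative[of z "partial i ?f"]
      by (simp add: hom_component_partial numeral_2_eq_2)
    have "((\<lambda>t. peval (\<lambda>k. x k + t * z k) (partial i F)) has_field_derivative
        (\<Sum>k\<in>I. peval (\<lambda>k. x k + 0 * z k) (partial k (partial i F)) * z k)) (at 0)"
      using vars_partial[of i F] forms_vars[OF F]
      by (intro peval_has_field_derivative[OF I]) (auto intro!: derivative_eq_intros)
    moreover have "peval (\<lambda>k. t * z k) (partial i ?f) = peval (\<lambda>k. x k + t * z k) (partial i F)" for t
    proof -
      have "(\<lambda>k. x k + (if k = j then 0 else t * z k)) = (\<lambda>k. x k + t * z k)"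
        by (auto simp: z_def)
      then show ?thesis using i by (simp add: peval_partial_local_equation)
    qed
    ultimately have 2: "((\<lambda>t. peval (\<lambda>k. t * z k) (partial i ?f)) has_field_derivative
        (\<Sum>k\<in>I. peval x (partial k (partial i F)) * z k)) (at 0)"
      by simp
    have "peval z (partial i ?q) = (\<Sum>k\<in>I. peval x (partial k (partial i F)) * z k)"
      by (rule DERIV_unique[OF 1 2])
    also have "\<dots> = (\<Sum>k\<in>?J. peval x (partial k (partial i F)) * y k)"
      using I by (intro sum.mono_neutral_cong_right) (auto simp: z_def)
    finally show ?thesis using ker[OF i] by simp
  qed
  moreover from this have "peval z ?q = 0"
    using forms_Euler[OF _ q, of z] I by simp
  moreover have "proj_point z \<in> proj_space ?J"
    unfolding proj_space_def using k yk by (intro CollectI exI[of _ z]) (auto simp: z_def)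
  ultimately have "proj_point z \<in> sing_locus ?J ?q"
    by (simp add: proj_point_in_sing_locus[OF q])
  then show False using smooth by (simp add: smooth_hypersurface_def)
qed

text \<open>
  The nodes whose tangent cone is given in the chart \<open>j\<close> are nondegenerate zeros of the partial
  derivatives in the directions of the chart together with the equation of the chart, that the
  coordinate \<open>j\<close> is \<open>1\<close>.
\<close>

lemma card_nodes:
  fixes F :: "'i cpoly"
  assumes I: "finite I" and F: "F \<in> forms I d" and S: "finite S" "S \<subseteq> sing_locus I F"
    and node: "\<And>P. P \<in> S \<Longrightarrow> node I F P"
  shows "card S \<le> card I * (2 + card I * (d + 1)) ^ card I"
proof -
  have "\<exists>j x. j \<in> I \<and> x \<in> P \<and> x j = 1 \<and>
      smooth_hypersurface (I - {j}) 2 (hom_component 2 (local_equation j x F))" if "P \<in> S" for P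
    using node[OF that] unfolding node_def ordinary_point_def tangent_cone_def by metis
  then obtain J X where JX: "\<And>P. P \<in> S \<Longrightarrow> J P \<in> I \<and> X P \<in> P \<and> X P (J P) = 1 \<and>
      smooth_hypersurface (I - {J P}) 2 (hom_component 2 (local_equation (J P) (X P) F))"
    by metis
  have PS: "P \<in> proj_space I" if "P \<in> S" for P
    using that S by (auto simp: sing_locus_def)
  have P: "P = proj_point (X P)" if "P \<in> S" for P
    using proj_space_rep(1)[OF PS[OF that]] JX[OF that] by blast
  have supp: "\<forall>i. i \<notin> I \<longrightarrow> X P i = 0" if "P \<in> S" for P
    using proj_space_rep(2)[OF PS[OF that]] JX[OF that] by blast
  have "card {P \<in> S. J P = j} \<le> (2 + card I * (d + 1)) ^ card I" if j: "j \<in> I" for j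
  proof -
    let ?Z = "X ` {P \<in> S. J P = j}"
    let ?f = "\<lambda>i. if i = j then PVar j - PConst 1 else partial i F"
    have "inj_on X {P \<in> S. J P = j}"
    proof (rule inj_onI)
      fix P Q assume "P \<in> {P \<in> S. J P = j}" "Q \<in> {P \<in> S. J P = j}" "X P = X Q"
      then show "P = Q" using P[of P] P[of Q] by simp
    qed
    then have "card {P \<in> S. J P = j} = card ?Z" by (simp add: card_image)
    also have "\<dots> \<le> (2 + card I * (d + 1)) ^ card I"
    proof (rule card_nondegenerate_zeros[OF I, where f = ?f])
      show "finite ?Z" using S by simp
      show "x i = 0" if "x \<in> ?Z" "i \<notin> I" for x i
        using that supp by blast
      show "?f i \<in> box_polys I (d + 1)" if "i \<in> I" for i
        using forms_box_polys[OF forms_partial[OF F, of i]] box_polys_affine[OF j, of 1]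
        by (auto elim: box_polys_mono)
      show "peval x (?f i) = 0" if "x \<in> ?Z" "i \<in> I" for x i
      proof -
        from that obtain P where P: "P \<in> S" "J P = j" "x = X P" by blast
        have "\<forall>x\<in>P. peval x (partial i F) = 0"
          using P(1) S(2) \<open>i \<in> I\<close> by (auto simp: sing_locus_def vanishes_at_def)
        then show ?thesis using JX[OF P(1)] P by auto
      qed
      show "\<forall>k\<in>I. y k = 0" if x: "x \<in> ?Z"
        and ker: "\<And>i. i \<in> I \<Longrightarrow> (\<Sum>k\<in>I. peval x (partial k (?f i)) * y k) = 0" for x y
      proof -
        have yj: "y j = 0"
        proof -
          have "0 = (\<Sum>k\<in>I. peval x (partial k (PVar j - PConst 1)) * y k)" using ker[OF j] by simp
          also have "\<dots> = (\<Sum>k\<in>I. if k = j then y k else 0)"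
            by (intro sum.cong) (auto simp: partial_affine)
          also have "\<dots> = y j" using I j by simp
          finally show ?thesis by simp
        qed
        have ker': "(\<Sum>k\<in>I - {j}. peval x (partial k (partial i F)) * y k) = 0"
          if "i \<in> I - {j}" for i
          using ker[of i] that I j yj by (simp add: sum.remove[of I j])
        from x obtain P where P: "P \<in> S" "J P = j" "x = X P" by blast
        have smooth: "smooth_hypersurface (I - {j}) 2 (hom_component 2 (local_equation j x F))"
          using JX[OF P(1)] P by simp
        have "y k = 0" if "k \<in> I - {j}" for k
          by (rule smooth_quadric_nondegenerate[OF I F j smooth ker' that])
        with yj show ?thesis by blast
      qed
    qed
    finally show ?thesis .
  qed
  then have "(\<Sum>j\<in>I. card {P \<in> S. J P = j}) \<le> (\<Sum>j\<in>I. (2 + card I * (d + 1)) ^ card I)"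
    by (rule sum_mono)
  moreover have "card S = (\<Sum>j\<in>I. card {P \<in> S. J P = j})"
  proof -
    have "S = (\<Union>j\<in>I. {P \<in> S. J P = j})" using JX by auto
    moreover have "card (\<Union>j\<in>I. {P \<in> S. J P = j}) = (\<Sum>j\<in>I. card {P \<in> S. J P = j})"
      using I S by (intro card_UN_disjoint) auto
    ultimately show ?thesis by simp
  qed
  ultimately show ?thesis by simp
qed

section \<open>Separating finitely many points of projective space\<close>

lemma forms_single: "keys a \<subseteq> I \<Longrightarrow> mdegree a = d \<Longrightarrow> single a c \<in> forms I d"
  by (simp add: forms_iff)

lemma forms_sum:
  assumes "\<And>x. x \<in> A \<Longrightarrow> f x \<in> forms I d"
  shows "sum f A \<in> forms I d"
proof -
  have "(\<Union>x\<in>A. keys (f x)) \<subseteq> monoms I d" using assms by (auto simp: forms_def)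
  then show ?thesis using keys_sum[of f A] by (auto simp: forms_def)
qed

lemma forms_mult: "p \<in> forms I d \<Longrightarrow> q \<in> forms I e \<Longrightarrow> p * q \<in> forms I (d + e)"
proof -
  assume pq: "p \<in> forms I d" "q \<in> forms I e"
  have "keys c \<subseteq> I \<and> mdegree c = d + e" if "c \<in> keys (p * q)" for c
  proof -
    obtain a b where c: "c = a + b" "a \<in> keys p" "b \<in> keys q"
      using \<open>c \<in> keys (p * q)\<close> keys_mult[of p q] by blast
    then have "keys a \<subseteq> I" "keys b \<subseteq> I" "mdegree a = d" "mdegree b = e"
      using pq by (auto simp: forms_iff)
    then show ?thesis using keys_add[of a b] by (auto simp: c(1) mdegree_add)
  qed
  then show ?thesis by (simp add: forms_iff)
qed

lemma forms_prod:
  "(\<And>x. x \<in> A \<Longrightarrow> f x \<in> forms I (e x)) \<Longrightarrow> prod f A \<in> forms I (sum e A)"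
proof (induction A rule: infinite_finite_induct)
  case (infinite A)
  show ?case by (simp add: infinite.hyps forms_iff)
next
  case empty
  show ?case by (simp add: forms_iff)
next
  case (insert x A)
  have "f x \<in> forms I (e x)" "prod f A \<in> forms I (sum e A)"
    using insert.prems by (auto intro: insert.IH)
  then show ?case using insert.hyps by (simp add: forms_mult)
qed

text \<open>
  If \<open>y b\<close> is nonzero, the linear forms that take the values \<open>y b * x k - y k * x b\<close> at \<open>x\<close> vanish
  jointly only at the multiples of \<open>y\<close>.
\<close>

lemma linear_form_separating:
  fixes I :: "'i set"
  assumes P: "P \<in> proj_space I" and Q: "Q \<in> proj_space I" and "P \<noteq> Q"
  shows "\<exists>l \<in> forms I 1. vanishes_at l Q \<and> \<not> vanishes_at l P"
proof -
  obtain x a where x: "P = proj_point x" "\<forall>i. i \<notin> I \<longrightarrow> x i = 0" "a \<in> I" "x a \<noteq> 0"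
    using P by (auto simp: proj_space_def)
  obtain y b where y: "Q = proj_point y" "\<forall>i. i \<notin> I \<longrightarrow> y i = 0" "b \<in> I" "y b \<noteq> 0"
    using Q by (auto simp: proj_space_def)
  define l :: "'i \<Rightarrow> 'i cpoly" where "l k = single (single k 1) (y b) + single (single b 1) (- y k)" for k
  have "\<exists>k\<in>I. y b * x k \<noteq> y k * x b"
  proof (rule ccontr)
    assume *: "\<not> ?thesis"
    have eq: "x = (\<lambda>k. x b / y b * y k)"
    proof
      fix k show "x k = x b / y b * y k"
        using * x(2) y(2,4) by (cases "k \<in> I") (auto simp: field_simps)
    qed
    have "x b / y b \<noteq> 0"
    proof
      assume "x b / y b = 0"
      then have "x a = 0" using fun_cong[OF eq, of a] by (simp only: mult_zero_left)
      with x(4) show False by simp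
    qed
    with eq have "x \<in> proj_point y" unfolding proj_point_def by blast
    then show False using proj_point_eq x(1) y(1) \<open>P \<noteq> Q\<close> by metis
  qed
  then obtain k where k: "k \<in> I" "y b * x k \<noteq> y k * x b" by blast
  have l: "l k \<in> forms I 1"
  proof -
    have "keys (l k) \<subseteq> keys (single (single k 1) (y b)) \<union> keys (single (single b 1) (- y k))"
      unfolding l_def by (rule keys_add)
    also have "\<dots> \<subseteq> {single k 1, single b 1}" by simp
    finally have "keys (l k) \<subseteq> {single k 1, single b 1}" .
    then show ?thesis using k(1) y(3) by (auto simp: forms_iff)
  qed
  have "peval y (l k) = 0" "peval x (l k) \<noteq> 0"
    using k(2) by (auto simp: l_def)
  then show ?thesis
    unfolding x(1) y(1) by (intro bexI[OF _ l]) (simp add: vanishes_at_proj_point[OF l])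
qed

lemma not_in_zariski_closure_finite:
  assumes S: "finite S" "S \<subseteq> proj_space I" and P: "P \<in> proj_space I" "P \<notin> S"
  shows "P \<notin> zariski_closure I S"
proof -
  have "\<forall>Q\<in>S. \<exists>l. l \<in> forms I 1 \<and> vanishes_at l Q \<and> \<not> vanishes_at l P"
    using linear_form_separating[OF P(1)] S P(2) by (metis subsetD)
  from bchoice[OF this] obtain l where
    l: "\<forall>Q\<in>S. l Q \<in> forms I 1 \<and> vanishes_at (l Q) Q \<and> \<not> vanishes_at (l Q) P" ..
  let ?G = "\<Prod>Q\<in>S. l Q"
  have G: "?G \<in> forms I (\<Sum>Q\<in>S. 1)"
    using l by (intro forms_prod) blast
  have "vanishes_at ?G Q" if "Q \<in> S" for Q
    using l that S(1) unfolding vanishes_at_def by auto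
  moreover have "\<not> vanishes_at ?G P"
  proof -
    obtain x where x: "P = proj_point x" using P(1) by (auto simp: proj_space_def)
    have "peval x (l Q) \<noteq> 0" if "Q \<in> S" for Q
      using l that unfolding x by (metis vanishes_at_proj_point)
    then show ?thesis
      unfolding x vanishes_at_proj_point[OF G] using S(1) by simp
  qed
  ultimately show ?thesis using G unfolding zariski_closure_def by blast
qed

section \<open>Diagonal hypersurfaces\<close>

text \<open>
  The homogenisation in degree \<open>d\<close>, with respect to the variable \<open>0\<close>, of
  \<open>\<Sum>i\<in>{1..n}. c i * u (x i)\<close>.
\<close>

definition diagonal_form :: "nat \<Rightarrow> nat \<Rightarrow> (nat \<Rightarrow> complex) \<Rightarrow> complex poly \<Rightarrow> nat cpoly" where
  "diagonal_form n d c u = (\<Sum>i\<in>{1..n}. \<Sum>k\<le>d.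
     single (single 0 (d - k) + single i k) (c i * coeff u k))"

definition affine_point :: "nat \<Rightarrow> (nat \<Rightarrow> complex) \<Rightarrow> nat \<Rightarrow> complex" where
  "affine_point n f i = (if i = 0 then 1 else if i \<le> n then f i else 0)"

lemma poly_eq_sum_atMost:
  fixes u :: "complex poly"
  assumes "degree u \<le> d"
  shows "poly u x = (\<Sum>k\<le>d. coeff u k * x ^ k)"
  unfolding poly_altdef using assms
  by (intro sum.mono_neutral_left) (auto simp: coeff_eq_0)

lemma peval_diagonal_form:
  "peval x (diagonal_form n d c u) = (\<Sum>i\<in>{1..n}. c i * (\<Sum>k\<le>d. coeff u k * (x 0 ^ (d - k) * x i ^ k)))"
  by (simp add: diagonal_form_def mono_eval_add sum_distrib_left mult_ac)

lemma peval_diagonal_form_affine: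
  assumes "degree u \<le> d" "x 0 = 1"
  shows "peval x (diagonal_form n d c u) = (\<Sum>i\<in>{1..n}. c i * poly u (x i))"
  by (simp add: peval_diagonal_form assms(2) poly_eq_sum_atMost[OF assms(1)])

lemma peval_diagonal_form_infinity:
  assumes "x 0 = 0"
  shows "peval x (diagonal_form n d c u) = (\<Sum>i\<in>{1..n}. c i * (coeff u d * x i ^ d))"
proof -
  have "(\<Sum>k\<le>d. coeff u k * (x 0 ^ (d - k) * x i ^ k)) = coeff u d * x i ^ d" for i
  proof -
    have "(\<Sum>k\<le>d. coeff u k * (x 0 ^ (d - k) * x i ^ k))
        = (\<Sum>k\<le>d. if k = d then coeff u k * x i ^ k else 0)"
      using assms by (intro sum.cong) (auto simp: power_0_left)
    then show ?thesis by simp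
  qed
  then show ?thesis by (simp add: peval_diagonal_form)
qed

lemma diagonal_form_in_forms: "diagonal_form n d c u \<in> forms {..n} d"
  unfolding diagonal_form_def
proof (intro forms_sum forms_single)
  fix i k assume "i \<in> {1..n}" "k \<in> {..d}"
  then show "keys (single 0 (d - k) + single i k) \<subseteq> {..n}"
    using keys_add[of "single (0::nat) (d - k)" "single i k"] by (force split: if_splits)
  show "mdegree (single 0 (d - k) + single i k) = d"
    using \<open>k \<in> {..d}\<close> by (simp add: mdegree_add)
qed

lemma peval_partial_separated:
  assumes K: "finite K" "i \<in> K"
    and sep: "\<And>t. peval (x(i := t)) F = (\<Sum>k\<in>K. g k ((x(i := t)) k))"
    and D: "(g i has_field_derivative D) (at (x i))"
  shows "peval x (partial i F) = D"
proof (rule DERIV_unique)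
  show "((\<lambda>t. peval (x(i := t)) F) has_field_derivative peval x (partial i F)) (at (x i))"
    using peval_partial_has_field_derivative[of x i F "x i"] by simp
  have "(\<Sum>k\<in>K. g k ((x(i := t)) k)) = g i t + (\<Sum>k\<in>K - {i}. g k (x k))" for t
    using K by (subst sum.remove[of K i]) auto
  moreover have "((\<lambda>t. g i t + (\<Sum>k\<in>K - {i}. g k (x k))) has_field_derivative D + 0) (at (x i))"
    by (intro DERIV_add D DERIV_const)
  ultimately show "((\<lambda>t. peval (x(i := t)) F) has_field_derivative D) (at (x i))"
    by (simp add: sep)
qed

lemma peval_partial_diagonal_form_affine:
  assumes "degree u \<le> d" "x 0 = 1" "i \<in> {1..n}"
  shows "peval x (partial i (diagonal_form n d c u)) = c i * poly (pderiv u) (x i)"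
proof (rule peval_partial_separated[where K = "{1..n}" and g = "\<lambda>k z. c k * poly u z"])
  fix t
  show "peval (x(i := t)) (diagonal_form n d c u) = (\<Sum>k = 1..n. c k * poly u ((x(i := t)) k))"
    using assms by (intro peval_diagonal_form_affine) auto
qed (use assms in \<open>auto intro!: derivative_eq_intros poly_DERIV\<close>)

lemma peval_partial_diagonal_form_infinity:
  assumes "x 0 = 0" "i \<in> {1..n}"
  shows "peval x (partial i (diagonal_form n d c u)) = c i * (coeff u d * (of_nat d * x i ^ (d - 1)))"
proof (rule peval_partial_separated[where K = "{1..n}" and g = "\<lambda>k z. c k * (coeff u d * z ^ d)"])
  fix t
  show "peval (x(i := t)) (diagonal_form n d c u) = (\<Sum>k = 1..n. c k * (coeff u d * (x(i := t)) k ^ d))"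
    using assms by (intro peval_diagonal_form_infinity) auto
qed (use assms in \<open>auto intro!: derivative_eq_intros\<close>)

lemma diagonal_form_nonzero:
  assumes "n \<ge> 1" "c 1 \<noteq> 0" "coeff u d \<noteq> 0" "d \<ge> 1"
  shows "diagonal_form n d c u \<noteq> 0"
proof
  assume "diagonal_form n d c u = 0"
  then have "0 = peval (\<lambda>i. if i = 1 then 1 else 0) (diagonal_form n d c u)" by simp
  also have "\<dots> = (\<Sum>i\<in>{1..n}. c i * (coeff u d * (if i = 1 then 1 else 0) ^ d))"
    by (rule peval_diagonal_form_infinity) simp
  also have "\<dots> = (\<Sum>i\<in>{1..n}. if i = 1 then c 1 * coeff u d else 0)"
    using assms(4) by (intro sum.cong) (auto simp: power_0_left)
  finally show False using assms by simp
qed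

definition multiple_roots :: "complex poly \<Rightarrow> complex set" where
  "multiple_roots u = {z. 2 \<le> order z u}"

lemma multiple_roots_iff:
  assumes "degree u \<ge> 1"
  shows "z \<in> multiple_roots u \<longleftrightarrow> poly u z = 0 \<and> poly (pderiv u) z = 0"
proof -
  have u: "u \<noteq> 0" "pderiv u \<noteq> 0" using assms by (auto simp: pderiv_eq_0_iff)
  show ?thesis
  proof (cases "poly u z = 0")
    case True
    then have "order z u = Suc (order z (pderiv u))" using u by (intro order_pderiv)
    then have "z \<in> multiple_roots u \<longleftrightarrow> order z (pderiv u) \<noteq> 0"
      by (simp only: multiple_roots_def mem_Collect_eq) linarith
    then show ?thesis using \<open>poly u z = 0\<close> u order_root[of "pderiv u" z] by blast
  next
    case False
    then show ?thesis by (simp add: multiple_roots_def order_0I)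
  qed
qed

lemma finite_multiple_roots: "u \<noteq> 0 \<Longrightarrow> finite (multiple_roots u)"
  by (rule finite_subset[OF _ poly_roots_finite[of u]]) (auto simp: multiple_roots_def order_root)

text \<open>
  An affine point is singular on the diagonal hypersurface with nonzero weights \<open>c i\<close> if and only if its coordinates
  are critical points of \<open>u\<close> whose critical values satisfy one linear relation. Generic weights
  are those for which critical values satisfy the relation only by being all zero.
\<close>

definition generic_weights :: "nat \<Rightarrow> complex poly \<Rightarrow> (nat \<Rightarrow> complex) \<Rightarrow> bool" where
  "generic_weights n u c \<longleftrightarrow> (\<forall>i\<in>{1..n}. c i \<noteq> 0) \<and>
     (\<forall>z. (\<forall>i\<in>{1..n}. poly (pderiv u) (z i) = 0) \<longrightarrow> (\<Sum>i\<in>{1..n}. c i * poly u (z i)) = 0 \<longrightarrow>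
       (\<forall>i\<in>{1..n}. poly u (z i) = 0))"

text \<open>
  At infinity the equation is of Fermat type, which is smooth. In the affine chart the derivatives in
  the directions \<open>i \<ge> 1\<close> ask for critical points of \<open>u\<close>, and the equation itself for a relation between
  their critical values.
\<close>

lemma sing_locus_diagonal_form:
  assumes d: "degree u = d" "d \<ge> 2" and gen: "generic_weights n u c"
  shows "sing_locus {..n} (diagonal_form n d c u)
    = (\<lambda>f. proj_point (affine_point n f)) ` PiE {1..n} (\<lambda>_. multiple_roots u)"
    (is "?S = ?T")
proof -
  let ?F = "diagonal_form n d c u"
  note F = diagonal_form_in_forms[of n d c u]
  note mult = multiple_roots_iff[of u]
  have lead: "coeff u d \<noteq> 0" using d by (metis leading_coeff_0_iff degree_0 not_numeral_le_zero)
  have c: "c i \<noteq> 0" if "i \<in> {1..n}" for i using gen that by (simp add: generic_weights_def)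
  have "P \<in> ?T" if P: "P \<in> ?S" for P
  proof -
    obtain x0 where x0: "P = proj_point x0" "\<forall>i. i \<notin> {..n} \<longrightarrow> x0 i = 0" "\<exists>i\<in>{..n}. x0 i \<noteq> 0"
      using P by (auto simp: sing_locus_def proj_space_def)
    have sing: "peval x0 ?F = 0" "\<forall>i\<in>{..n}. peval x0 (partial i ?F) = 0"
      using P proj_point_in_sing_locus[OF F, of x0] x0(1) by auto
    have "x0 0 \<noteq> 0"
    proof
      assume 0: "x0 0 = 0"
      have "x0 i = 0" if i: "i \<in> {1..n}" for i
      proof -
        have "c i * (coeff u d * (of_nat d * x0 i ^ (d - 1))) = 0"
          using sing(2) i peval_partial_diagonal_form_infinity[of x0 i n d c u] 0 by simp
        then show ?thesis using c[OF i] lead d by simp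
      qed
      with 0 have "\<forall>i\<in>{..n}. x0 i = 0" by (metis atLeastAtMost_iff atMost_iff less_one not_le)
      with x0(3) show False by blast
    qed
    define x where "x = (\<lambda>i. inverse (x0 0) * x0 i)"
    have x: "x \<in> proj_point x0" "x 0 = 1"
      using \<open>x0 0 \<noteq> 0\<close> by (auto simp: x_def proj_point_def)
    have Px: "P = proj_point x" using proj_point_eq[OF x(1)] x0(1) by simp
    then have sing: "peval x ?F = 0" "\<forall>i\<in>{..n}. peval x (partial i ?F) = 0"
      using P proj_point_in_sing_locus[OF F, of x] by auto
    have crit: "poly (pderiv u) (x i) = 0" if i: "i \<in> {1..n}" for i
    proof -
      have "c i * poly (pderiv u) (x i) = 0"
        using sing(2) i d(1) x(2) peval_partial_diagonal_form_affine[of u d x i n c] by simp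
      then show ?thesis using c[OF i] by simp
    qed
    moreover have "(\<Sum>i\<in>{1..n}. c i * poly u (x i)) = 0"
      using sing(1) d(1) x(2) by (simp add: peval_diagonal_form_affine)
    ultimately have "\<forall>i\<in>{1..n}. poly u (x i) = 0"
      using gen unfolding generic_weights_def by blast
    with crit have "restrict x {1..n} \<in> PiE {1..n} (\<lambda>_. multiple_roots u)"
      using mult d by auto
    moreover have "affine_point n (restrict x {1..n}) = x"
    proof
      fix i show "affine_point n (restrict x {1..n}) i = x i"
        using x(2) x0(2) by (cases "i \<le> n") (auto simp: affine_point_def x_def)
    qed
    ultimately show ?thesis unfolding Px by (intro image_eqI[of _ _ "restrict x {1..n}"]) simp_all
  qed
  moreover have "proj_point (affine_point n f) \<in> ?S"
    if f: "f \<in> PiE {1..n} (\<lambda>_. multiple_roots u)" for f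
  proof -
    let ?x = "affine_point n f"
    have 1: "?x 0 = 1" by (simp add: affine_point_def)
    have "f i \<in> multiple_roots u" if "i \<in> {1..n}" for i using f that by (rule PiE_mem)
    then have "?x i \<in> multiple_roots u" if "i \<in> {1..n}" for i
      using that by (simp add: affine_point_def)
    then have root: "poly u (?x i) = 0" "poly (pderiv u) (?x i) = 0" if "i \<in> {1..n}" for i
      using mult d that by auto
    have zero: "peval ?x ?F = 0"
      using root d 1 by (simp add: peval_diagonal_form_affine)
    have part: "peval ?x (partial i ?F) = 0" if "i \<in> {1..n}" for i
      using root[OF that] that d(1) 1 by (simp add: peval_partial_diagonal_form_affine)
    \<comment> \<open>The derivative in the direction \<open>0\<close> vanishes by Euler's relation.\<close>
    have "peval ?x (partial 0 ?F) = 0"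
    proof -
      have "0 = (\<Sum>i\<in>{..n}. ?x i * peval ?x (partial i ?F))"
        using forms_Euler[OF _ F, of ?x] zero by simp
      also have "\<dots> = (\<Sum>i\<in>{0}. ?x i * peval ?x (partial i ?F))"
        using part by (intro sum.mono_neutral_right) auto
      finally show ?thesis using 1 by simp
    qed
    with part have "\<forall>i\<in>{..n}. peval ?x (partial i ?F) = 0"
      by (metis atLeastAtMost_iff atMost_iff less_one not_le)
    moreover have "proj_point ?x \<in> proj_space {..n}"
      unfolding proj_space_def using 1 by (intro CollectI exI[of _ ?x]) (auto simp: affine_point_def)
    ultimately show ?thesis using zero proj_point_in_sing_locus[OF F] by blast
  qed
  ultimately show ?thesis by blast
qed

lemma inj_on_affine_points:
  "inj_on (\<lambda>f. proj_point (affine_point n f)) (PiE {1..n} A)"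
proof (rule inj_onI)
  fix f g assume f: "f \<in> PiE {1..n} A" "g \<in> PiE {1..n} A"
    and "proj_point (affine_point n f) = proj_point (affine_point n g)"
  then have "affine_point n f \<in> proj_point (affine_point n g)"
    using self_in_proj_point by metis
  then obtain c where c: "affine_point n f = (\<lambda>i. c * affine_point n g i)"
    by (auto simp: proj_point_def)
  have "c = 1" using fun_cong[OF c, of 0] by (simp add: affine_point_def)
  show "f = g"
  proof (rule PiE_ext[OF f])
    fix i assume "i \<in> {1..n}"
    then show "f i = g i" using fun_cong[OF c, of i] \<open>c = 1\<close> by (simp add: affine_point_def)
  qed
qed

lemma hom_component_sum: "hom_component k (sum f A) = (\<Sum>x\<in>A. hom_component k (f x))"
  by (rule poly_mapping_eqI) (simp add: lookup_hom_component lookup_sum)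

lemma hom_component_single: "hom_component k (single a c) = (if mdegree a = k then single a c else 0)"
  by (rule poly_mapping_eqI) (auto simp: lookup_hom_component lookup_single when_def)

lemma Taylor_coefficients_at_root:
  fixes u :: "complex poly"
  assumes "u \<noteq> 0"
  shows "k < order z u \<Longrightarrow> coeff (pcompose u [:z, 1:]) k = 0"
    and "coeff (pcompose u [:z, 1:]) (order z u) \<noteq> 0"
proof -
  obtain w where w: "u = [:- z, 1:] ^ order z u * w" "\<not> [:- z, 1:] dvd w"
    using order_decomp[OF assms] by blast
  have pow: "pcompose ([:- z, 1:] ^ e) [:z, 1:] = Polynomial.monom 1 e" for e
  proof (induction e)
    case (Suc e)
    have "pcompose [:- z, 1:] [:z, 1:] = [:0, 1:]" by (simp add: pcompose_pCons)
    then show ?case by (simp only: power_Suc pcompose_mult Suc.IH) (simp add: monom_altdef)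
  qed (simp add: pcompose_1)
  have eq: "pcompose u [:z, 1:] = Polynomial.monom 1 (order z u) * pcompose w [:z, 1:]"
    by (subst w(1)) (simp add: pcompose_mult pow)
  show "k < order z u \<Longrightarrow> coeff (pcompose u [:z, 1:]) k = 0"
    by (simp add: eq coeff_monom_mult)
  show "coeff (pcompose u [:z, 1:]) (order z u) \<noteq> 0"
    using w(2) by (simp add: eq coeff_monom_mult poly_eq_0_iff_dvd)
qed

lemma smooth_Fermat:
  fixes b :: "nat \<Rightarrow> complex"
  assumes n: "n \<ge> 1" and e: "e \<ge> 1" and b: "\<And>i. i \<in> {1..n} \<Longrightarrow> b i \<noteq> 0"
  shows "smooth_hypersurface {1..n} e (\<Sum>i\<in>{1..n}. single (single i e) (b i))"
    (is "smooth_hypersurface _ _ ?q")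
proof -
  have q: "?q \<in> forms {1..n} e"
    by (intro forms_sum forms_single) auto
  have "?q \<noteq> 0"
  proof
    assume "?q = 0"
    then have "0 = peval (\<lambda>i. if i = 1 then 1 else 0) ?q" by (simp only: peval_hom)
    also have "\<dots> = (\<Sum>i\<in>{1..n}. b i * (if i = 1 then 1 else 0) ^ e)" by simp
    also have "\<dots> = (\<Sum>i\<in>{1..n}. if i = 1 then b 1 else 0)"
      using e by (intro sum.cong) (auto simp: power_0_left)
    finally show False using n b[of 1] by simp
  qed
  moreover have "P \<notin> sing_locus {1..n} ?q" for P
  proof
    assume P: "P \<in> sing_locus {1..n} ?q"
    then obtain y where y: "P = proj_point y" "\<exists>i\<in>{1..n}. y i \<noteq> 0"
      by (auto simp: sing_locus_def proj_space_def)
    have "y i = 0" if i: "i \<in> {1..n}" for i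
    proof -
      have "peval y (partial i ?q) = b i * (of_nat e * y i ^ (e - 1))"
        by (rule peval_partial_separated[where K = "{1..n}" and g = "\<lambda>k z. b k * z ^ e"])
          (use i in \<open>auto intro!: derivative_eq_intros\<close>)
      then have "b i * (of_nat e * y i ^ (e - 1)) = 0"
        using P i proj_point_in_sing_locus[OF q, of y] y(1) by auto
      then show ?thesis using b[OF i] e by simp
    qed
    with y(2) show False by blast
  qed
  ultimately show ?thesis using q by (auto simp: smooth_hypersurface_def)
qed

text \<open>
  The translated affine equation is a sum of Taylor expansions of \<open>u\<close>, each starting in degree \<open>e\<close>, so that
  its lowest homogeneous component is of Fermat type.
\<close>

lemma ordinary_point_diagonal_form:
  assumes n: "n \<ge> 1" and d: "degree u = d" "d \<ge> 2" and gen: "generic_weights n u c"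
    and e: "e \<ge> 2" "\<And>z. z \<in> multiple_roots u \<Longrightarrow> order z u = e"
    and P: "P \<in> sing_locus {..n} (diagonal_form n d c u)"
  shows "ordinary_point {..n} e (diagonal_form n d c u) P"
proof -
  let ?F = "diagonal_form n d c u"
  have u: "u \<noteq> 0" using d by auto
  obtain f where f: "f \<in> PiE {1..n} (\<lambda>_. multiple_roots u)" "P = proj_point (affine_point n f)"
    using P sing_locus_diagonal_form[OF d gen] by auto
  define x where "x = affine_point n f"
  define v where "v i = pcompose u [:f i, 1:]" for i
  have x: "x 0 = 1" "i \<in> {1..n} \<Longrightarrow> x i = f i" for i by (auto simp: x_def affine_point_def)
  have ord: "order (f i) u = e" if "i \<in> {1..n}" for i
    using e(2) PiE_mem[OF f(1) that] by simp
  have coeff_v: "k < e \<Longrightarrow> coeff (v i) k = 0" "coeff (v i) e \<noteq> 0" if "i \<in> {1..n}" for i k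
    using Taylor_coefficients_at_root(1)[OF u, of k "f i"]
      Taylor_coefficients_at_root(2)[OF u, of "f i"] ord[OF that] by (simp_all add: v_def)
  have "e \<le> d" using ord[of 1] order_degree[OF u, of "f 1"] n d by simp
  define L where "L = (\<Sum>i\<in>{1..n}. \<Sum>k\<le>d. single (single i k) (c i * coeff (v i) k))"
  have "local_equation 0 x ?F = L"
  proof (rule peval_inject)
    fix y
    have "peval y (local_equation 0 x ?F) = (\<Sum>i\<in>{1..n}. c i * poly u (f i + y i))"
      using d(1) x by (simp add: peval_local_equation peval_diagonal_form_affine)
    also have "\<dots> = (\<Sum>i\<in>{1..n}. c i * poly (v i) (y i))"
      by (simp add: v_def poly_pcompose)
    also have "\<dots> = peval y L"
    proof -
      have "degree (v i) \<le> d" for i using degree_pcompose_le[of u "[:f i, 1:]"] d(1) by (simp add: v_def)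
      then have "poly (v i) (y i) = (\<Sum>k\<le>d. coeff (v i) k * y i ^ k)" for i
        by (intro poly_eq_sum_atMost)
      then show ?thesis by (simp add: L_def sum_distrib_left mult_ac)
    qed
    finally show "peval y (local_equation 0 x ?F) = peval y L" .
  qed
  have comp: "hom_component k L = (\<Sum>i\<in>{1..n}. single (single i k) (c i * coeff (v i) k))"
    if "k \<le> d" for k
    unfolding L_def hom_component_sum hom_component_single using that by simp
  have smooth: "smooth_hypersurface {1..n} e (hom_component e L)"
    unfolding comp[OF \<open>e \<le> d\<close>] using n e(1) gen coeff_v
    by (intro smooth_Fermat) (auto simp: generic_weights_def)
  have mult: "multiplicity_at_0 L = e"
    unfolding multiplicity_at_0_def
  proof (rule Least_equality)
    show "hom_component e L \<noteq> 0" using smooth by (simp add: smooth_hypersurface_def)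
    show "e \<le> k" if "hom_component k L \<noteq> 0" for k
    proof (rule ccontr)
      assume "\<not> e \<le> k"
      then have "hom_component k L = 0" using comp[of k] \<open>e \<le> d\<close> coeff_v by simp
      with that show False by simp
    qed
  qed
  have "isolated_singularity {..n} ?F P"
  proof -
    have fin: "finite (sing_locus {..n} ?F)"
      unfolding sing_locus_diagonal_form[OF d gen]
      by (intro finite_imageI finite_PiE) (simp_all add: finite_multiple_roots[OF u])
    have "P \<notin> zariski_closure {..n} (sing_locus {..n} ?F - {P})"
      using fin P by (intro not_in_zariski_closure_finite) (auto simp: sing_locus_def)
    then show ?thesis using P by (simp add: isolated_singularity_def)
  qed
  moreover have "{..n} - {0} = {1..n}" by auto
  moreover have "x \<in> P" using f(2) self_in_proj_point by (simp add: x_def)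
  ultimately show ?thesis
    unfolding ordinary_point_def tangent_cone_def using smooth mult x(1) \<open>local_equation 0 x ?F = L\<close>
    by (intro conjI bexI[of _ 0] bexI[of _ x]) auto
qed

section \<open>Generic weights and the nodal deformation\<close>

lemma sum_powers_poly:
  "(\<Sum>i\<in>{1..n}. s ^ i * w i) = poly (\<Sum>i\<in>{1..n}. Polynomial.monom (w i) i) s"
  for s :: complex
  by (simp add: poly_sum poly_monom mult.commute)

text \<open>
  Only the finitely many families of critical values matter, and each nonzero family excludes
  only the roots of one nonzero polynomial.
\<close>

lemma finite_nongeneric_powers:
  fixes u :: "complex poly"
  assumes "degree u \<ge> 1"
  shows "finite {s. \<not> generic_weights n u (\<lambda>i. s ^ i)}"
proof -
  define V where "V = poly u ` {z. poly (pderiv u) z = 0}"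
  define W where "W = {w \<in> PiE {1..n} (\<lambda>_. V). \<exists>i\<in>{1..n}. w i \<noteq> 0}"
  have "finite V"
    unfolding V_def using assms by (intro finite_imageI poly_roots_finite) (auto simp: pderiv_eq_0_iff)
  then have "finite (PiE {1..n} (\<lambda>_. V))" by (intro finite_PiE) simp_all
  then have "finite W" by (rule rev_finite_subset) (auto simp: W_def)
  have "finite {s. (\<Sum>i\<in>{1..n}. s ^ i * w i) = 0}" if "w \<in> W" for w
  proof -
    obtain k where k: "k \<in> {1..n}" "w k \<noteq> 0" using \<open>w \<in> W\<close> by (auto simp: W_def)
    have "coeff (\<Sum>i\<in>{1..n}. Polynomial.monom (w i) i) k = w k"
      using k(1) by (simp add: coeff_sum)
    then have "(\<Sum>i\<in>{1..n}. Polynomial.monom (w i) i) \<noteq> 0" using k(2) by auto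
    then show ?thesis unfolding sum_powers_poly by (rule poly_roots_finite)
  qed
  with \<open>finite W\<close> have fin: "finite (insert 0 (\<Union>w\<in>W. {s. (\<Sum>i\<in>{1..n}. s ^ i * w i) = 0}))"
    by blast
  have "generic_weights n u (\<lambda>i. s ^ i)"
    if "s \<noteq> 0" and s: "\<And>w. w \<in> W \<Longrightarrow> (\<Sum>i\<in>{1..n}. s ^ i * w i) \<noteq> 0" for s
    unfolding generic_weights_def
  proof (intro conjI allI impI)
    show "\<forall>i\<in>{1..n}. s ^ i \<noteq> 0" using \<open>s \<noteq> 0\<close> by simp
    fix z assume crit: "\<forall>i\<in>{1..n}. poly (pderiv u) (z i) = 0"
      and rel: "(\<Sum>i\<in>{1..n}. s ^ i * poly u (z i)) = 0"
    let ?w = "restrict (\<lambda>i. poly u (z i)) {1..n}"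
    have "?w \<in> PiE {1..n} (\<lambda>_. V)" using crit by (auto simp: V_def)
    moreover have "(\<Sum>i\<in>{1..n}. s ^ i * ?w i) = 0" using rel by simp
    ultimately have "\<forall>i\<in>{1..n}. ?w i = 0" using s[of ?w] unfolding W_def by blast
    then show "\<forall>i\<in>{1..n}. poly u (z i) = 0" by simp
  qed
  then have "{s. \<not> generic_weights n u (\<lambda>i. s ^ i)}
      \<subseteq> insert 0 (\<Union>w\<in>W. {s. (\<Sum>i\<in>{1..n}. s ^ i * w i) = 0})"
    by blast
  then show ?thesis using fin by (rule finite_subset)
qed

text \<open>
  Moving apart the \<open>m\<close>-fold root \<open>0\<close> into \<open>m div 2\<close> double roots, leaving a simple root at \<open>0\<close> if
  \<open>m\<close> is odd. The additional simple roots at negative integers raise the degree to \<open>d\<close>.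
\<close>

definition root_deformation :: "nat \<Rightarrow> nat \<Rightarrow> complex \<Rightarrow> complex poly" where
  "root_deformation d m t = [:0, 1:] ^ (m mod 2) * (\<Prod>j\<in>{1..m div 2}. [:- (of_nat j * t), 1:] ^ 2) *
     (\<Prod>j\<in>{1..d - m}. [:of_nat j, 1:])"

lemma order_prod:
  fixes f :: "'a \<Rightarrow> complex poly"
  assumes "finite A" "\<And>x. x \<in> A \<Longrightarrow> f x \<noteq> 0"
  shows "order a (prod f A) = (\<Sum>x\<in>A. order a (f x))"
  using assms by (induction A rule: finite_induct) (auto simp: order_mult)

lemma order_linear_power: "order a ([:- b, 1:] ^ e) = (if a = b then e else 0)" for a b :: complex
proof (cases "a = b")
  case True
  then show ?thesis using order_power_n_n[of a e] by simp
qed (auto intro!: order_0I)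

lemma degree_root_deformation:
  assumes "d \<ge> m"
  shows "degree (root_deformation d m t) = d"
proof -
  have "degree (\<Prod>j\<in>{1..m div 2}. [:- (of_nat j * t), 1:] ^ 2) = 2 * (m div 2)"
    by (subst degree_prod_sum_eq) (simp_all add: degree_power_eq)
  moreover have "degree (\<Prod>j\<in>{1..d - m}. [:of_nat j, 1:: complex:]) = d - m"
    by (subst degree_prod_sum_eq) simp_all
  ultimately show ?thesis
    using assms unfolding root_deformation_def
    by (simp add: degree_mult_eq degree_power_eq)
qed

lemma order_root_deformation:
  "order z (root_deformation d m t) = (if z = 0 then m mod 2 else 0) +
     (\<Sum>j\<in>{1..m div 2}. if z = of_nat j * t then 2 else 0) +
     (\<Sum>j\<in>{1..d - m}. if z = - of_nat j then 1 else 0)"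
proof -
  have "order z ([:0, 1:] ^ (m mod 2)) = (if z = 0 then m mod 2 else 0)"
    using order_linear_power[of z 0 "m mod 2"] by simp
  moreover have "order z (\<Prod>j\<in>{1..m div 2}. [:- (of_nat j * t), 1:] ^ 2)
      = (\<Sum>j\<in>{1..m div 2}. if z = of_nat j * t then 2 else 0)"
    by (subst order_prod) (auto simp only: order_linear_power finite_atLeastAtMost power_eq_0_iff
        pCons_eq_0_iff one_neq_zero)
  moreover have "order z (\<Prod>j\<in>{1..d - m}. [:of_nat j, 1:])
      = (\<Sum>j\<in>{1..d - m}. if z = - of_nat j then 1 else 0)"
    using order_linear_power[of z "- of_nat j" 1 for j] by (subst order_prod) auto
  ultimately show ?thesis
    unfolding root_deformation_def by (subst order_mult, simp, subst order_mult, simp_all)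
qed

lemma of_nat_neq_minus_of_nat: "k \<ge> 1 \<Longrightarrow> (of_nat j :: complex) \<noteq> - of_nat k"
proof
  assume "k \<ge> 1" "(of_nat j :: complex) = - of_nat k"
  then have "(of_nat (j + k) :: complex) = 0" by simp
  then show False using \<open>k \<ge> 1\<close> by (simp only: of_nat_eq_0_iff)
qed

lemma root_deformation_at_0:
  assumes "m > 1"
  shows "multiple_roots (root_deformation d m 0) = {0}" "order 0 (root_deformation d m 0) = m"
proof -
  have "(\<Sum>j\<in>{1..d - m}. if (0::complex) = - of_nat j then 1 else (0::nat)) = 0"
    by (intro sum.neutral) auto
  then show 0: "order 0 (root_deformation d m 0) = m"
    unfolding order_root_deformation by simp
  have "order z (root_deformation d m 0) \<le> 1" if "z \<noteq> 0" for z
  proof -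
    have "(\<Sum>j\<in>{1..d - m}. if z = - of_nat j then 1 else (0::nat)) \<le> 1"
    proof (cases "\<exists>k. z = - of_nat k")
      case True
      then show ?thesis by (auto simp: sum.delta')
    qed (simp add: sum.neutral)
    then show ?thesis using that unfolding order_root_deformation by simp
  qed
  then show "multiple_roots (root_deformation d m 0) = {0}"
    using 0 assms unfolding multiple_roots_def by force
qed

text \<open>
  At positive integers \<open>t\<close> the positive double roots are distinct from each other, from \<open>0\<close>, and from the
  negative simple roots.
\<close>

lemma root_deformation_at_positive:
  assumes "\<tau> \<ge> 1"
  shows "multiple_roots (root_deformation d m (of_nat \<tau>)) = (\<lambda>j. of_nat (j * \<tau>)) ` {1..m div 2}"
    and "z \<in> multiple_roots (root_deformation d m (of_nat \<tau>)) \<Longrightarrow>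
      order z (root_deformation d m (of_nat \<tau>)) = 2"
proof -
  let ?u = "root_deformation d m (of_nat \<tau>)"
  let ?R = "(\<lambda>j. of_nat (j * \<tau>) :: complex) ` {1..m div 2}"
  have R: "order z ?u = 2" if z: "z \<in> ?R" for z
  proof -
    obtain k where k: "k \<in> {1..m div 2}" "z = of_nat (k * \<tau>)" using z by blast
    have "z \<noteq> 0" using k assms by (simp only: of_nat_eq_0_iff) simp
    moreover have "(\<Sum>j\<in>{1..m div 2}. if z = of_nat j * of_nat \<tau> then 2 else 0)
        = (\<Sum>j\<in>{1..m div 2}. if j = k then 2 else (0::nat))"
      using assms by (intro sum.cong) (auto simp: k(2))
    moreover have "(\<Sum>j\<in>{1..d - m}. if z = - of_nat j then 1 else (0::nat)) = 0"
      unfolding k(2) by (intro sum.neutral) (auto simp: of_nat_neq_minus_of_nat simp del: of_nat_mult)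
    ultimately show ?thesis unfolding order_root_deformation using k(1) by simp
  qed
  have notR: "order z ?u \<le> 1" if "z \<notin> ?R" for z
  proof -
    have "(\<Sum>j\<in>{1..m div 2}. if z = of_nat j * of_nat \<tau> then 2 else (0::nat)) = 0"
      using that by (intro sum.neutral) auto
    moreover have "(if z = 0 then m mod 2 else 0) + (\<Sum>j\<in>{1..d - m}. if z = - of_nat j then 1 else (0::nat)) \<le> 1"
    proof (cases "z = 0")
      case True
      then have "(\<Sum>j\<in>{1..d - m}. if z = - of_nat j then 1 else (0::nat)) = 0"
        by (intro sum.neutral) auto
      moreover have "m mod 2 \<le> 1" by linarith
      ultimately show ?thesis by simp
    next
      case False
      show ?thesis
      proof (cases "\<exists>k. z = - of_nat k")
        case True
        then show ?thesis using False by (auto simp: sum.delta')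
      qed (use False in \<open>simp add: sum.neutral\<close>)
    qed
    ultimately show ?thesis unfolding order_root_deformation by simp
  qed
  show eq: "multiple_roots ?u = ?R"
  proof (intro equalityI subsetI)
    fix z assume "z \<in> multiple_roots ?u"
    then have "\<not> order z ?u \<le> 1" by (simp add: multiple_roots_def)
    then show "z \<in> ?R" using notR by blast
  next
    fix z assume "z \<in> ?R"
    from R[OF this] show "z \<in> multiple_roots ?u" by (simp add: multiple_roots_def)
  qed
  show "z \<in> multiple_roots ?u \<Longrightarrow> order z ?u = 2" using R eq by blast
qed

section \<open>Specialisation in a polynomial family\<close>

definition poly_fun :: "(complex \<Rightarrow> complex) \<Rightarrow> bool" where
  "poly_fun f \<longleftrightarrow> (\<exists>p. \<forall>t. f t = poly p t)"

lemma poly_fun_const: "poly_fun (\<lambda>t. c)"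
  unfolding poly_fun_def by (intro exI[of _ "[:c:]"]) simp

lemma poly_fun_id: "poly_fun (\<lambda>t. t)"
  unfolding poly_fun_def by (intro exI[of _ "[:0, 1:]"]) simp

lemma poly_fun_add: "poly_fun f \<Longrightarrow> poly_fun g \<Longrightarrow> poly_fun (\<lambda>t. f t + g t)"
  unfolding poly_fun_def by (metis poly_add)

lemma poly_fun_mult: "poly_fun f \<Longrightarrow> poly_fun g \<Longrightarrow> poly_fun (\<lambda>t. f t * g t)"
  unfolding poly_fun_def by (metis poly_mult)

lemma poly_fun_sum: "(\<And>x. x \<in> A \<Longrightarrow> poly_fun (f x)) \<Longrightarrow> poly_fun (\<lambda>t. \<Sum>x\<in>A. f x t)"
  by (induction A rule: infinite_finite_induct) (simp_all add: poly_fun_const poly_fun_add)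

lemma poly_fun_prod: "(\<And>x. x \<in> A \<Longrightarrow> poly_fun (f x)) \<Longrightarrow> poly_fun (\<lambda>t. \<Prod>x\<in>A. f x t)"
  by (induction A rule: infinite_finite_induct) (simp_all add: poly_fun_const poly_fun_mult)

lemma poly_fun_power: "poly_fun f \<Longrightarrow> poly_fun (\<lambda>t. f t ^ k)"
  by (induction k) (simp_all add: poly_fun_const poly_fun_mult)

lemma poly_fun_eq_0:
  assumes "poly_fun f" "infinite {t. f t = 0}"
  shows "f t = 0"
proof -
  obtain p where p: "\<forall>t. f t = poly p t" using assms(1) by (auto simp: poly_fun_def)
  then have "p = 0" using assms(2) poly_roots_finite[of p] by auto
  with p show ?thesis by simp
qed

lemma poly_fun_peval:
  assumes "\<And>a. poly_fun (\<lambda>t. x t a)"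
  shows "poly_fun (\<lambda>t. peval (x t) G)"
  unfolding peval_alt mono_eval_def
  by (intro poly_fun_sum poly_fun_mult poly_fun_const poly_fun_prod poly_fun_power assms)

lemma poly_fun_coeff_mult:
  assumes "\<And>k. poly_fun (\<lambda>t. coeff (p t) k)" "\<And>k. poly_fun (\<lambda>t. coeff (q t) k)"
  shows "poly_fun (\<lambda>t. coeff (p t * q t) k)"
  unfolding coeff_mult by (intro poly_fun_sum poly_fun_mult assms)

lemma poly_fun_coeff_prod:
  assumes "\<And>x k. x \<in> A \<Longrightarrow> poly_fun (\<lambda>t. coeff (p x t) k)"
  shows "poly_fun (\<lambda>t. coeff (\<Prod>x\<in>A. p x t) k)"
  using assms
proof (induction A arbitrary: k rule: infinite_finite_induct)
  case (insert x A)
  have "poly_fun (\<lambda>t. coeff (p x t * (\<Prod>x\<in>A. p x t)) k)"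
    by (intro poly_fun_coeff_mult insert.IH insert.prems) simp_all
  then show ?case using insert.hyps by simp
qed (simp_all add: poly_fun_const)

lemma poly_fun_coeff_root_deformation: "poly_fun (\<lambda>t. coeff (root_deformation d m t) k)"
proof -
  have lin: "poly_fun (\<lambda>t. coeff [:- (of_nat j * t), 1:] k)" for j k
  proof (cases k)
    case 0
    have "poly_fun (\<lambda>t. (- of_nat j) * t)" by (intro poly_fun_mult poly_fun_const poly_fun_id)
    then show ?thesis using 0 by simp
  next
    case (Suc l)
    then show ?thesis by (simp add: poly_fun_const)
  qed
  show ?thesis
    unfolding root_deformation_def power2_eq_square
    by (intro poly_fun_coeff_mult poly_fun_coeff_prod lin poly_fun_const)
qed

lemma lookup_diagonal_form:
  "lookup (diagonal_form n d c u) a = (\<Sum>i\<in>{1..n}. \<Sum>k\<le>d.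
     c i * (coeff u k * (if single 0 (d - k) + single i k = a then 1 else 0)))"
  unfolding diagonal_form_def lookup_sum lookup_single
  by (intro sum.cong) (simp_all add: when_def)

section \<open>Hypersurfaces with an ordinary point as limits of nodal hypersurfaces\<close>

lemma severi_bound:
  assumes "severi n d \<delta> \<noteq> {}"
  shows "\<delta> \<le> card {..n} * (2 + card {..n} * (d + 1)) ^ card {..n}"
proof -
  obtain F where F: "F \<in> forms {..n} d" "finite (sing_locus {..n} F)"
    "card (sing_locus {..n} F) = \<delta>" "\<forall>P\<in>sing_locus {..n} F. node {..n} F P"
    using assms unfolding severi_def by auto
  have "card (sing_locus {..n} F) \<le> card {..n} * (2 + card {..n} * (d + 1)) ^ card {..n}"
    by (rule card_nodes[OF _ F(1,2)]) (use F(4) in auto)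
  with F(3) show ?thesis by simp
qed

lemma zariski_closure_empty: "zariski_closure I {} = {}"
proof -
  have 1: "1 \<in> forms I 0" by (simp add: forms_iff)
  have "\<not> vanishes_at 1 P" if "P \<in> proj_space I" for P
  proof -
    obtain x where "P = proj_point x" using \<open>P \<in> proj_space I\<close> by (auto simp: proj_space_def)
    then show ?thesis using vanishes_at_proj_point[OF 1, of x] by simp
  qed
  with 1 show ?thesis unfolding zariski_closure_def by blast
qed

text \<open>
  The maximum defining \<open>delta\<close> exists because empty Severi varieties have empty closure and the nonempty ones
  have a bounded number of nodes.
\<close>

lemma delta_ge:
  assumes "hypersurface_point F \<in> zariski_closure (monoms {..n} d) (severi n d \<delta>)"
  shows "\<delta> \<le> delta n d F"
  unfolding delta_def
proof (rule Greatest_le_nat)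
  show "hypersurface_point F \<in> zariski_closure (monoms {..n} d) (severi n d \<delta>)" by fact
  fix \<epsilon> assume "hypersurface_point F \<in> zariski_closure (monoms {..n} d) (severi n d \<epsilon>)"
  then have "severi n d \<epsilon> \<noteq> {}" using zariski_closure_empty by force
  then show "\<epsilon> \<le> card {..n} * (2 + card {..n} * (d + 1)) ^ card {..n}" by (rule severi_bound)
qed

lemma nodal_diagonal_form:
  assumes n: "n \<ge> 1" and d: "d \<ge> m" "m > 1" and \<tau>: "\<tau> \<ge> 1"
    and gen: "generic_weights n (root_deformation d m (of_nat \<tau>)) c"
  shows "hypersurface_point (diagonal_form n d c (root_deformation d m (of_nat \<tau>)))
    \<in> severi n d ((m div 2) ^ n)"
proof -
  let ?u = "root_deformation d m (of_nat \<tau>)"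
  let ?F = "diagonal_form n d c ?u"
  note deg = degree_root_deformation[OF d(1), of "of_nat \<tau>"]
  have d2: "d \<ge> 2" using d by simp
  note sing = sing_locus_diagonal_form[OF deg d2 gen]
  have u: "?u \<noteq> 0" using deg d2 by auto
  have "c 1 \<noteq> 0" using gen n by (simp add: generic_weights_def)
  moreover have "coeff ?u d \<noteq> 0" using deg u by (metis leading_coeff_0_iff)
  ultimately have "?F \<noteq> 0" using n d2 by (intro diagonal_form_nonzero) auto
  moreover have "finite (sing_locus {..n} ?F)"
    unfolding sing by (intro finite_imageI finite_PiE) (simp_all add: finite_multiple_roots[OF u])
  moreover have "card (sing_locus {..n} ?F) = (m div 2) ^ n"
  proof -
    have "inj_on (\<lambda>j. of_nat (j * \<tau>) :: complex) {1..m div 2}"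
    proof (rule inj_onI)
      fix i j assume "(of_nat (i * \<tau>) :: complex) = of_nat (j * \<tau>)"
      then have "i * \<tau> = j * \<tau>" by (simp only: of_nat_eq_iff)
      then show "i = j" using \<tau> by simp
    qed
    then have "card (multiple_roots ?u) = m div 2"
      unfolding root_deformation_at_positive(1)[OF \<tau>] by (simp add: card_image)
    then show ?thesis
      unfolding sing card_image[OF inj_on_affine_points] by (simp add: card_PiE)
  qed
  moreover have "node {..n} ?F P" if "P \<in> sing_locus {..n} ?F" for P
    unfolding node_def
    by (rule ordinary_point_diagonal_form[OF n deg d2 gen _ _ that])
      (simp_all add: root_deformation_at_positive(2)[OF \<tau>])
  ultimately show ?thesis
    unfolding severi_def using diagonal_form_in_forms by blast
qed

theorem theorem1p4:
  fixes d m n :: nat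
  assumes "n \<ge> 3" and "d \<ge> m" and "m > 1"
  shows "\<exists>F \<in> forms {..n} d. F \<noteq> 0 \<and>
    (\<exists>P. ordinary_point {..n} m F P \<and> sing_locus {..n} F = {P}) \<and>
    delta n d F \<ge> (m div 2) ^ n"
proof -
  have n: "n \<ge> 1" and d: "d \<ge> 2" using assms by auto
  let ?u = "root_deformation d m"
  define X where "X t s = diagonal_form n d (\<lambda>i. s ^ i) (?u t)" for t s
  note deg = degree_root_deformation[OF assms(2)]
  have fin: "finite {s. \<not> generic_weights n (?u t) (\<lambda>i. s ^ i)}" for t
    by (rule finite_nongeneric_powers) (use deg d in simp)
  then obtain s where gen: "generic_weights n (?u 0) (\<lambda>i. s ^ i)"
    using ex_new_if_finite[OF infinite_UNIV_char_0] by blast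
  have form: "X t r \<in> forms {..n} d" for t r
    unfolding X_def by (rule diagonal_form_in_forms)
  have u: "?u 0 \<noteq> 0" using deg[of 0] d by auto
  have "s \<noteq> 0" using gen n by (auto simp: generic_weights_def)
  moreover have "coeff (?u 0) d \<noteq> 0" using deg[of 0] u by (metis leading_coeff_0_iff)
  ultimately have nonzero: "X 0 s \<noteq> 0"
    unfolding X_def using n d by (intro diagonal_form_nonzero) auto
  define P where "P = proj_point (affine_point n (\<lambda>i\<in>{1..n}. 0))"
  have "PiE {1..n} (\<lambda>_. {0}) = {\<lambda>i\<in>{1..n}. 0 :: complex}"
    by (simp add: PiE_eq_singleton)
  then have sing: "sing_locus {..n} (X 0 s) = {P}"
    unfolding X_def P_def sing_locus_diagonal_form[OF deg d gen] root_deformation_at_0(1)[OF assms(3)]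
    by simp
  have ordinary: "ordinary_point {..n} m (X 0 s) P"
    unfolding X_def
    by (rule ordinary_point_diagonal_form[OF n deg d gen])
      (use sing assms(3) root_deformation_at_0[OF assms(3)] in \<open>auto simp: X_def\<close>)
  have "hypersurface_point (X 0 s) \<in> zariski_closure (monoms {..n} d) (severi n d ((m div 2) ^ n))"
  proof -
    have "\<exists>a\<in>monoms {..n} d. lookup (X 0 s) a \<noteq> 0"
    proof -
      obtain a where "a \<in> keys (X 0 s)" using nonzero by (metis keys_eq_empty all_not_in_conv)
      then show ?thesis using form[of 0 s] by (auto simp: forms_def in_keys_iff)
    qed
    moreover have "\<forall>a. a \<notin> monoms {..n} d \<longrightarrow> lookup (X 0 s) a = 0"
      using form[of 0 s] by (auto simp: forms_def in_keys_iff)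
    ultimately have "hypersurface_point (X 0 s) \<in> proj_space (monoms {..n} d)"
      unfolding proj_space_def hypersurface_point_def by blast
    moreover have "vanishes_at G (hypersurface_point (X 0 s))"
      if G: "G \<in> forms (monoms {..n} d) e"
        and van: "\<forall>Q\<in>severi n d ((m div 2) ^ n). vanishes_at G Q" for G e
    proof -
      have "peval (lookup (X (of_nat \<tau>) s)) G = 0" if \<tau>: "\<tau> \<ge> 1" for \<tau>
      \<comment> \<open>The value \<open>s\<close> is generic at \<open>t = 0\<close> but perhaps not at \<open>\<tau>\<close>, hence the detour over all \<open>r\<close>.\<close>
      proof (rule poly_fun_eq_0[where f = "\<lambda>r. peval (lookup (X (of_nat \<tau>) r)) G"])
        show "poly_fun (\<lambda>r. peval (lookup (X (of_nat \<tau>) r)) G)"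
          unfolding X_def lookup_diagonal_form
          by (intro poly_fun_peval poly_fun_sum poly_fun_mult poly_fun_power poly_fun_id poly_fun_const)
        have "peval (lookup (X (of_nat \<tau>) r)) G = 0"
          if "generic_weights n (?u (of_nat \<tau>)) (\<lambda>i. r ^ i)" for r
        proof -
          have "vanishes_at G (hypersurface_point (X (of_nat \<tau>) r))"
            unfolding X_def using van nodal_diagonal_form[OF n assms(2,3) \<tau> that] by blast
          then show ?thesis unfolding hypersurface_point_def vanishes_at_proj_point[OF G] .
        qed
        then have "- {r. peval (lookup (X (of_nat \<tau>) r)) G = 0}
            \<subseteq> {r. \<not> generic_weights n (?u (of_nat \<tau>)) (\<lambda>i. r ^ i)}"
          by blast
        then have "finite (- {r. peval (lookup (X (of_nat \<tau>) r)) G = 0})"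
          using fin by (rule finite_subset)
        then show "infinite {r. peval (lookup (X (of_nat \<tau>) r)) G = 0}"
          using infinite_UNIV_char_0[where 'a = complex] finite_compl by blast
      qed
      then have "of_nat ` {1..} \<subseteq> {t. peval (lookup (X t s)) G = 0}" by auto
      moreover have "infinite (of_nat ` {1::nat..} :: complex set)"
        by (simp add: finite_image_iff inj_on_def infinite_Ici)
      ultimately have "infinite {t. peval (lookup (X t s)) G = 0}" by (metis finite_subset)
      moreover have "poly_fun (\<lambda>t. peval (lookup (X t s)) G)"
        unfolding X_def lookup_diagonal_form
        by (intro poly_fun_peval poly_fun_sum poly_fun_mult poly_fun_coeff_root_deformation
            poly_fun_const)
      ultimately have "peval (lookup (X 0 s)) G = 0" by (rule poly_fun_eq_0[rotated])
      then show ?thesis unfolding hypersurface_point_def vanishes_at_proj_point[OF G] .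
    qed
    ultimately show ?thesis unfolding zariski_closure_def by blast
  qed
  then have "delta n d (X 0 s) \<ge> (m div 2) ^ n" by (rule delta_ge)
  with form nonzero ordinary sing show ?thesis by blast
qed

end
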